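(* Let $H$ be a Hopf algebra over a field $k$ with adjoint map $\mathrm{ad}$, let $\phi\in Z^2_{\mathrm{ad}}(H;H)$ be an adjoint $2$-cocycle, and let $A=(H\otimes k[[t]])/(t^2)$ with Hopf algebra structure maps inherited from $H$. Then the map $R:A\otimes A\to A\otimes A$ defined by $R=R_{\mathrm{ad}+t\phi}$ satisfies the Yang--Baxter equation $$(R\otimes 1)(1\otimes R)(R\otimes 1)=(1\otimes R)(R\otimes 1)(1\otimes R).$$
   Context: $H$ has multiplication $\mu$, comultiplication $\Delta$, antipode $S$; Sweedler notation $\Delta(y)=y_{(1)}\otimes y_{(2)}$; $\tau(x\otimes y)=y\otimes x$; $1$ in formulas for maps is an identity map. Adjoint map: $\mathrm{ad}(x\otimes y)=S(y_{(1)})\,x\,y_{(2)}$. An adjoint $2$-cocycle, $\phi\in Z^2_{\mathrm{ad}}(H;H)$, is a $k$-linear map $\phi:H\otimes H\to H$ such that $\mathrm{ad}(\phi\otimes 1)+\phi(\mathrm{ad}\otimes 1)-\phi(1\otimes\mu)=0$ and $(\phi\otimes\mu)(1\otimes\tau\otimes 1)(\Delta\otimes\Delta)-(1\otimes\mu)(\tau\otimes 1)(1\otimes\Delta)(1\otimes\phi)(\tau\otimes 1)(1\otimes\Delta)=0$. $A$ is a Hopf algebra over $k[[t]]/(t^2)$, with all structure maps the $k[[t]]/(t^2)$-linear extensions of those of $H$ (as a vector space $A\cong H\oplus tH$); tensor products of $A$ are over $k[[t]]/(t^2)$, and $\mathrm{ad},\phi$ are extended $k[[t]]/(t^2)$-linearly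 to $A\otimes A\to A$. For a linear map $q:A\otimes A\to A$, $R_q=(1\otimes q)(\tau\otimes 1)(1\otimes\Delta):A\otimes A\to A\otimes A$. *)

theory Defs
  imports
    "HOL-Library.Poly_Mapping"
    "HOL-Library.FuncSet"
    "HOL-Library.Product_Plus"
    "HOL-Computational_Algebra.Formal_Power_Series"
begin

section \<open>Tensor powers of a module\<close>

text \<open>
  Throughout, \<open>s\<close> is the scalar multiplication of a module \<open>M\<close> (locale \<^locale>\<open>module\<close>) over a
  commutative ring \<open>R\<close>. The tensor product over \<open>R\<close> of \<open>n\<close> copies of \<open>M\<close> is the free \<open>R\<close>-module
  on the lists of length \<open>n\<close> over \<open>M\<close> modulo the multilinearity relations. All tensor powers live in
  one type, that of cosets in the free module on all lists, so that they are strictly associative: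
  the tensor product of elements (\<open>tmult\<close>) is induced by concatenation of lists, and
  \<open>x\<^sub>1 \<otimes> x\<^sub>2 \<otimes> x\<^sub>3\<close> is \<open>pure_tensor s [x\<^sub>1, x\<^sub>2, x\<^sub>3]\<close>. The power with \<open>n = 1\<close> is
  \<open>M\<close> itself (via \<open>x \<mapsto> [x]\<close>) and the power with \<open>n = 0\<close> is \<open>R\<close> (via \<open>c \<mapsto> c \<cdot> []\<close>).
\<close>

type_synonym ('r, 'm) tensor = "('m list \<Rightarrow>\<^sub>0 'r) set"

definition fscale :: "'r::comm_ring_1 \<Rightarrow> ('x \<Rightarrow>\<^sub>0 'r) \<Rightarrow> ('x \<Rightarrow>\<^sub>0 'r)" where
  "fscale c u = Poly_Mapping.map (\<lambda>a. c * a) u"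

definition fext :: "('x \<Rightarrow> ('y \<Rightarrow>\<^sub>0 'r)) \<Rightarrow> ('x \<Rightarrow>\<^sub>0 'r) \<Rightarrow> ('y \<Rightarrow>\<^sub>0 'r::comm_ring_1)" where
  "fext P u = (\<Sum>x\<in>Poly_Mapping.keys u. fscale (Poly_Mapping.lookup u x) (P x))"

definition fconcat :: "('m list \<Rightarrow>\<^sub>0 'r) \<Rightarrow> ('m list \<Rightarrow>\<^sub>0 'r) \<Rightarrow> ('m list \<Rightarrow>\<^sub>0 'r::comm_ring_1)" where
  "fconcat u v = fext (\<lambda>xs. fext (\<lambda>ys. Poly_Mapping.single (xs @ ys) 1) v) u"

definition tensor_rels ::
    "('r::comm_ring_1 \<Rightarrow> 'm::ab_group_add \<Rightarrow> 'm) \<Rightarrow> ('m list \<Rightarrow>\<^sub>0 'r) set" where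
  "tensor_rels s =
     {Poly_Mapping.single (xs @ (x + y) # ys) 1 - Poly_Mapping.single (xs @ x # ys) 1
        - Poly_Mapping.single (xs @ y # ys) 1 | xs x y ys. True} \<union>
     {Poly_Mapping.single (xs @ s c x # ys) 1 - Poly_Mapping.single (xs @ x # ys) c
        | xs c x ys. True}"

definition tensor_null ::
    "('r::comm_ring_1 \<Rightarrow> 'm::ab_group_add \<Rightarrow> 'm) \<Rightarrow> ('m list \<Rightarrow>\<^sub>0 'r) set" where
  "tensor_null s = module.span fscale (tensor_rels s)"

definition tcls ::
    "('r::comm_ring_1 \<Rightarrow> 'm::ab_group_add \<Rightarrow> 'm) \<Rightarrow> ('m list \<Rightarrow>\<^sub>0 'r) \<Rightarrow> ('r, 'm) tensor" where
  "tcls s u = {v. v - u \<in> tensor_null s}"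

definition pure_tensor ::
    "('r::comm_ring_1 \<Rightarrow> 'm::ab_group_add \<Rightarrow> 'm) \<Rightarrow> 'm list \<Rightarrow> ('r, 'm) tensor" where
  "pure_tensor s xs = tcls s (Poly_Mapping.single xs 1)"

definition tensor_power ::
    "('r::comm_ring_1 \<Rightarrow> 'm::ab_group_add \<Rightarrow> 'm) \<Rightarrow> nat \<Rightarrow> ('r, 'm) tensor set" where
  "tensor_power s n = tcls s ` {u. \<forall>xs\<in>Poly_Mapping.keys u. length xs = n}"

definition tzero :: "('r::comm_ring_1 \<Rightarrow> 'm::ab_group_add \<Rightarrow> 'm) \<Rightarrow> ('r, 'm) tensor" where
  "tzero s = tcls s 0"

definition tadd :: "('r::comm_ring_1 \<Rightarrow> 'm::ab_group_add \<Rightarrow> 'm)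
    \<Rightarrow> ('r, 'm) tensor \<Rightarrow> ('r, 'm) tensor \<Rightarrow> ('r, 'm) tensor" where
  "tadd s X Y = (\<Union>u\<in>X. \<Union>v\<in>Y. tcls s (u + v))"

definition tdiff :: "('r::comm_ring_1 \<Rightarrow> 'm::ab_group_add \<Rightarrow> 'm)
    \<Rightarrow> ('r, 'm) tensor \<Rightarrow> ('r, 'm) tensor \<Rightarrow> ('r, 'm) tensor" where
  "tdiff s X Y = (\<Union>u\<in>X. \<Union>v\<in>Y. tcls s (u - v))"

definition tscale :: "('r::comm_ring_1 \<Rightarrow> 'm::ab_group_add \<Rightarrow> 'm)
    \<Rightarrow> 'r \<Rightarrow> ('r, 'm) tensor \<Rightarrow> ('r, 'm) tensor" where
  "tscale s c X = (\<Union>u\<in>X. tcls s (fscale c u))"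

definition tmult :: "('r::comm_ring_1 \<Rightarrow> 'm::ab_group_add \<Rightarrow> 'm)
    \<Rightarrow> ('r, 'm) tensor \<Rightarrow> ('r, 'm) tensor \<Rightarrow> ('r, 'm) tensor" where
  "tmult s X Y = (\<Union>u\<in>X. \<Union>v\<in>Y. tcls s (fconcat u v))"


section \<open>Linear maps between tensor powers\<close>

definition tlinear :: "('r::comm_ring_1 \<Rightarrow> 'm::ab_group_add \<Rightarrow> 'm)
    \<Rightarrow> nat \<Rightarrow> nat \<Rightarrow> (('r, 'm) tensor \<Rightarrow> ('r, 'm) tensor) set" where
  "tlinear s m n = {f \<in> tensor_power s m \<rightarrow> tensor_power s n.
     (\<forall>X\<in>tensor_power s m. \<forall>Y\<in>tensor_power s m. f (tadd s X Y) = tadd s (f X) (f Y)) \<and>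
     (\<forall>c. \<forall>X\<in>tensor_power s m. f (tscale s c X) = tscale s c (f X))}"

text \<open>The linear map from the \<open>m\<close>-th to the \<open>n\<close>-th tensor power with prescribed values on pure
  tensors. It exists if \<open>F\<close> is multilinear on lists of length \<open>m\<close>.\<close>

definition tlift :: "('r::comm_ring_1 \<Rightarrow> 'm::ab_group_add \<Rightarrow> 'm)
    \<Rightarrow> nat \<Rightarrow> nat \<Rightarrow> ('m list \<Rightarrow> ('r, 'm) tensor) \<Rightarrow> ('r, 'm) tensor \<Rightarrow> ('r, 'm) tensor" where
  "tlift s m n F = (THE h. h \<in> tlinear s m n \<inter> extensional (tensor_power s m) \<and>
     (\<forall>xs. length xs = m \<longrightarrow> h (pure_tensor s xs) = F xs))"

text \<open>\<open>tmap s (m, n) f (p, q) g\<close> is \<open>f \<otimes> g\<close> for \<open>f\<close> from the \<open>m\<close>-th to the \<open>n\<close>-th tensor power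
  and \<open>g\<close> from the \<open>p\<close>-th to the \<open>q\<close>-th.\<close>

definition tmap :: "('r::comm_ring_1 \<Rightarrow> 'm::ab_group_add \<Rightarrow> 'm)
    \<Rightarrow> nat \<times> nat \<Rightarrow> (('r, 'm) tensor \<Rightarrow> ('r, 'm) tensor)
    \<Rightarrow> nat \<times> nat \<Rightarrow> (('r, 'm) tensor \<Rightarrow> ('r, 'm) tensor)
    \<Rightarrow> ('r, 'm) tensor \<Rightarrow> ('r, 'm) tensor" where
  "tmap s a f b g = tlift s (fst a + fst b) (snd a + snd b) (\<lambda>xs. tmult s
     (f (pure_tensor s (take (fst a) xs))) (g (pure_tensor s (drop (fst a) xs))))"

definition tflip :: "('r::comm_ring_1 \<Rightarrow> 'm::ab_group_add \<Rightarrow> 'm) \<Rightarrow> ('r, 'm) tensor \<Rightarrow> ('r, 'm) tensor" where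
  "tflip s = tlift s 2 2 (\<lambda>xs. pure_tensor s (rev xs))"


section \<open>Hopf algebras\<close>

text \<open>All structure maps go between tensor powers: \<open>\<mu>: H \<otimes> H \<rightarrow> H\<close>, \<open>\<eta>: k \<rightarrow> H\<close>, \<open>\<Delta>: H \<rightarrow> H \<otimes> H\<close>,
  \<open>\<epsilon>: H \<rightarrow> k\<close> and \<open>S: H \<rightarrow> H\<close>, where \<open>H\<close> and \<open>k\<close> are the tensor powers with \<open>n = 1\<close> and \<open>n = 0\<close>.\<close>

locale hopf_algebra = vector_space scale
  for scale :: "'k::field \<Rightarrow> 'h::ab_group_add \<Rightarrow> 'h" +
  fixes \<mu> \<eta> \<Delta> \<epsilon> S :: "('k, 'h) tensor \<Rightarrow> ('k, 'h) tensor"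
  assumes mult_linear: "\<mu> \<in> tlinear scale 2 1"
    and unit_linear: "\<eta> \<in> tlinear scale 0 1"
    and comult_linear: "\<Delta> \<in> tlinear scale 1 2"
    and counit_linear: "\<epsilon> \<in> tlinear scale 1 0"
    and antipode_linear: "S \<in> tlinear scale 1 1"
    and mult_assoc: "X \<in> tensor_power scale 3 \<Longrightarrow>
      \<mu> (tmap scale (2, 1) \<mu> (1, 1) id X) = \<mu> (tmap scale (1, 1) id (2, 1) \<mu> X)"
    and unit_left: "X \<in> tensor_power scale 1 \<Longrightarrow> \<mu> (tmap scale (0, 1) \<eta> (1, 1) id X) = X"
    and unit_right: "X \<in> tensor_power scale 1 \<Longrightarrow> \<mu> (tmap scale (1, 1) id (0, 1) \<eta> X) = X"
    and comult_coassoc: "X \<in> tensor_power scale 1 \<Longrightarrow>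
      tmap scale (1, 2) \<Delta> (1, 1) id (\<Delta> X) = tmap scale (1, 1) id (1, 2) \<Delta> (\<Delta> X)"
    and counit_left: "X \<in> tensor_power scale 1 \<Longrightarrow> tmap scale (1, 0) \<epsilon> (1, 1) id (\<Delta> X) = X"
    and counit_right: "X \<in> tensor_power scale 1 \<Longrightarrow> tmap scale (1, 1) id (1, 0) \<epsilon> (\<Delta> X) = X"
    and comult_mult: "X \<in> tensor_power scale 2 \<Longrightarrow>
      \<Delta> (\<mu> X) = tmap scale (2, 1) \<mu> (2, 1) \<mu>
        (tmap scale (1, 1) id (3, 3) (tmap scale (2, 2) (tflip scale) (1, 1) id)
          (tmap scale (1, 2) \<Delta> (1, 2) \<Delta> X))"
    and comult_unit: "X \<in> tensor_power scale 0 \<Longrightarrow> \<Delta> (\<eta> X) = tmap scale (0, 1) \<eta> (0, 1) \<eta> X"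
    and counit_mult: "X \<in> tensor_power scale 2 \<Longrightarrow> \<epsilon> (\<mu> X) = tmap scale (1, 0) \<epsilon> (1, 0) \<epsilon> X"
    and counit_unit: "X \<in> tensor_power scale 0 \<Longrightarrow> \<epsilon> (\<eta> X) = X"
    and antipode_left: "X \<in> tensor_power scale 1 \<Longrightarrow> \<mu> (tmap scale (1, 1) S (1, 1) id (\<Delta> X)) = \<eta> (\<epsilon> X)"
    and antipode_right: "X \<in> tensor_power scale 1 \<Longrightarrow> \<mu> (tmap scale (1, 1) id (1, 1) S (\<Delta> X)) = \<eta> (\<epsilon> X)"


section \<open>The adjoint map, adjoint cocycles and the map \<open>R\<^sub>q\<close>\<close>

text \<open>\<open>ad(x \<otimes> y) = S(y\<^sub>1) x y\<^sub>2\<close>, that is,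
  \<open>ad = \<mu> (1 \<otimes> \<mu>) (S \<otimes> 1 \<otimes> 1) (\<tau> \<otimes> 1) (1 \<otimes> \<Delta>)\<close>.\<close>

definition adjoint_map ::
    "('r::comm_ring_1 \<Rightarrow> 'm::ab_group_add \<Rightarrow> 'm)
      \<Rightarrow> (('r, 'm) tensor \<Rightarrow> ('r, 'm) tensor) \<Rightarrow> (('r, 'm) tensor \<Rightarrow> ('r, 'm) tensor)
      \<Rightarrow> (('r, 'm) tensor \<Rightarrow> ('r, 'm) tensor) \<Rightarrow> ('r, 'm) tensor \<Rightarrow> ('r, 'm) tensor" where
  "adjoint_map s \<mu> \<Delta> S X =
     \<mu> (tmap s (1, 1) id (2, 1) \<mu>
       (tmap s (1, 1) S (2, 2) id
         (tmap s (2, 2) (tflip s) (1, 1) id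
           (tmap s (1, 1) id (1, 2) \<Delta> X))))"

definition adjoint_2_cocycles ::
    "('r::comm_ring_1 \<Rightarrow> 'm::ab_group_add \<Rightarrow> 'm)
      \<Rightarrow> (('r, 'm) tensor \<Rightarrow> ('r, 'm) tensor) \<Rightarrow> (('r, 'm) tensor \<Rightarrow> ('r, 'm) tensor)
      \<Rightarrow> (('r, 'm) tensor \<Rightarrow> ('r, 'm) tensor) \<Rightarrow> (('r, 'm) tensor \<Rightarrow> ('r, 'm) tensor) set" where
  "adjoint_2_cocycles s \<mu> \<Delta> S = {\<phi> \<in> tlinear s 2 1.
     (\<forall>X\<in>tensor_power s 3.
        tdiff s
          (tadd s (adjoint_map s \<mu> \<Delta> S (tmap s (2, 1) \<phi> (1, 1) id X))
                  (\<phi> (tmap s (2, 1) (adjoint_map s \<mu> \<Delta> S) (1, 1) id X)))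
          (\<phi> (tmap s (1, 1) id (2, 1) \<mu> X)) = tzero s) \<and>
     (\<forall>X\<in>tensor_power s 2.
        tdiff s
          (tmap s (2, 1) \<phi> (2, 1) \<mu>
            (tmap s (1, 1) id (3, 3) (tmap s (2, 2) (tflip s) (1, 1) id)
              (tmap s (1, 2) \<Delta> (1, 2) \<Delta> X)))
          (tmap s (1, 1) id (2, 1) \<mu>
            (tmap s (2, 2) (tflip s) (1, 1) id
              (tmap s (1, 1) id (1, 2) \<Delta>
                (tmap s (1, 1) id (2, 1) \<phi>
                  (tmap s (2, 2) (tflip s) (1, 1) id
                    (tmap s (1, 1) id (1, 2) \<Delta> X)))))) = tzero s)}"

text \<open>\<open>R\<^sub>q = (1 \<otimes> q) (\<tau> \<otimes> 1) (1 \<otimes> \<Delta>)\<close>\<close>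

definition R_map ::
    "('r::comm_ring_1 \<Rightarrow> 'm::ab_group_add \<Rightarrow> 'm)
      \<Rightarrow> (('r, 'm) tensor \<Rightarrow> ('r, 'm) tensor) \<Rightarrow> (('r, 'm) tensor \<Rightarrow> ('r, 'm) tensor)
      \<Rightarrow> ('r, 'm) tensor \<Rightarrow> ('r, 'm) tensor" where
  "R_map s \<Delta> q X =
     tmap s (1, 1) id (2, 1) q
       (tmap s (2, 2) (tflip s) (1, 1) id
         (tmap s (1, 1) id (1, 2) \<Delta> X))"


section \<open>The ring \<open>k[[t]]/(t\<^sup>2)\<close>\<close>

lemma fps_X_power2_dvd_iff:
  "fps_X ^ 2 dvd (f :: 'k::field fps) \<longleftrightarrow> fps_nth f 0 = 0 \<and> fps_nth f 1 = 0"
proof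
  assume "fps_X ^ 2 dvd f"
  then obtain g where "f = fps_X ^ 2 * g" ..
  then show "fps_nth f 0 = 0 \<and> fps_nth f 1 = 0" by (simp add: fps_X_power_mult_nth)
next
  assume a: "fps_nth f 0 = 0 \<and> fps_nth f 1 = 0"
  have "f = fps_X ^ 2 * fps_shift 2 f"
  proof (rule fps_ext)
    fix n
    show "fps_nth f n = fps_nth (fps_X ^ 2 * fps_shift 2 f) n"
      using a less_2_cases[of n] by (auto simp: fps_X_power_mult_nth not_less dest!: le_Suc_ex)
  qed
  then show "fps_X ^ 2 dvd f" ..
qed

quotient_type (overloaded) 'k trunc = "'k::field fps" / "\<lambda>f g. fps_X ^ 2 dvd f - g"
  by (rule equivpI) (auto simp: reflp_def symp_def transp_def fps_X_power2_dvd_iff)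

instantiation trunc :: (field) comm_ring_1
begin

lift_definition zero_trunc :: "'a trunc" is 0 .
lift_definition one_trunc :: "'a trunc" is 1 .
lift_definition plus_trunc :: "'a trunc \<Rightarrow> 'a trunc \<Rightarrow> 'a trunc" is "(+)"
  by (simp add: fps_X_power2_dvd_iff)
lift_definition minus_trunc :: "'a trunc \<Rightarrow> 'a trunc \<Rightarrow> 'a trunc" is "(-)"
  by (simp add: fps_X_power2_dvd_iff)
lift_definition uminus_trunc :: "'a trunc \<Rightarrow> 'a trunc" is uminus
  by (simp add: fps_X_power2_dvd_iff)
lift_definition times_trunc :: "'a trunc \<Rightarrow> 'a trunc \<Rightarrow> 'a trunc" is "(*)"
  by (simp add: fps_X_power2_dvd_iff fps_mult_nth)

instance
  by standard (transfer; simp add: fps_X_power2_dvd_iff algebra_simps)+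

end

lift_definition trunc_const :: "'k::field \<Rightarrow> 'k trunc" is fps_const .

lift_definition trunc_t :: "'k::field trunc" is fps_X .

lift_definition trunc_coeff0 :: "'k::field trunc \<Rightarrow> 'k" is "\<lambda>f. fps_nth f 0"
  by (simp add: fps_X_power2_dvd_iff)

lift_definition trunc_coeff1 :: "'k::field trunc \<Rightarrow> 'k" is "\<lambda>f. fps_nth f 1"
  by (simp add: fps_X_power2_dvd_iff)

lemma trunc_coeff_simps [simp]:
  "trunc_coeff0 (0 :: 'k::field trunc) = 0" "trunc_coeff1 (0 :: 'k trunc) = 0"
  "trunc_coeff0 (1 :: 'k trunc) = 1" "trunc_coeff1 (1 :: 'k trunc) = 0"
  "trunc_coeff0 (c + d :: 'k trunc) = trunc_coeff0 c + trunc_coeff0 d"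
  "trunc_coeff1 (c + d :: 'k trunc) = trunc_coeff1 c + trunc_coeff1 d"
  "trunc_coeff0 (c * d :: 'k trunc) = trunc_coeff0 c * trunc_coeff0 d"
  "trunc_coeff1 (c * d :: 'k trunc) = trunc_coeff0 c * trunc_coeff1 d + trunc_coeff1 c * trunc_coeff0 d"
  "trunc_coeff0 (trunc_const a :: 'k trunc) = a" "trunc_coeff1 (trunc_const a :: 'k trunc) = 0"
  "trunc_coeff0 (trunc_t :: 'k trunc) = 0" "trunc_coeff1 (trunc_t :: 'k trunc) = 1"
  by (transfer; simp add: fps_mult_nth)+

lemma trunc_decomp: "c = trunc_const (trunc_coeff0 c) + trunc_const (trunc_coeff1 c) * trunc_t"
  by transfer (simp add: fps_X_power2_dvd_iff fps_mult_nth)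


section \<open>Extension of scalars to \<open>k[[t]]/(t\<^sup>2)\<close>\<close>

text \<open>\<open>A = (H \<otimes> k[[t]])/(t\<^sup>2)\<close> is realised as \<open>H \<oplus> tH\<close>: the pair \<open>(x, y)\<close> stands for \<open>x + ty\<close>.
  Below this is shown to be a module over \<open>k[[t]]/(t\<^sup>2)\<close> with the universal property of the
  extension of scalars of \<open>H\<close>, where \<open>H\<close> is included in \<open>A\<close> by \<open>x \<mapsto> (x, 0)\<close>.\<close>

definition trunc_scale :: "('k::field \<Rightarrow> 'h::ab_group_add \<Rightarrow> 'h) \<Rightarrow> 'k trunc \<Rightarrow> 'h \<times> 'h \<Rightarrow> 'h \<times> 'h" where
  "trunc_scale s c z =
     (s (trunc_coeff0 c) (fst z), s (trunc_coeff0 c) (snd z) + s (trunc_coeff1 c) (fst z))"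

lemma module_trunc_scale:
  assumes "vector_space s"
  shows "module (trunc_scale s)"
proof -
  interpret vector_space s by fact
  show ?thesis
    by unfold_locales (auto simp: trunc_scale_def prod_eq_iff algebra_simps)
qed

lemma trunc_scale_universal:
  fixes f :: "'h::ab_group_add \<Rightarrow> 'm::ab_group_add"
  assumes "vector_space s" and "module sM"
    and "\<And>x y. f (x + y) = f x + f y"
    and "\<And>c x. f (s c x) = sM (trunc_const c) (f x)"
  shows "\<exists>!F. module_hom (trunc_scale s) sM F \<and> (\<forall>x. F (x, 0) = f x)"
proof (rule ex1I)
  interpret H: vector_space s by fact
  interpret M: module sM by fact
  interpret A: module "trunc_scale s" by (rule module_trunc_scale) fact
  have c: "sM c v = sM (trunc_const (trunc_coeff0 c)) v + sM (trunc_const (trunc_coeff1 c)) (sM trunc_t v)" for c v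
    by (subst trunc_decomp) (simp add: M.scale_left_distrib)
  have t2: "trunc_t * trunc_t = (0 :: 'a trunc)"
    by transfer (simp add: fps_X_power2_dvd_iff fps_mult_nth)
  show "module_hom (trunc_scale s) sM (\<lambda>z. f (fst z) + sM trunc_t (f (snd z))) \<and>
      (\<forall>x. f (fst (x, 0 :: 'h)) + sM trunc_t (f (snd (x, 0 :: 'h))) = f x)"
  proof -
    interpret f: additive f by standard fact
    have "f (fst (trunc_scale s c z)) + sM trunc_t (f (snd (trunc_scale s c z))) =
        sM c (f (fst z) + sM trunc_t (f (snd z)))" for c z
      unfolding c[of c] by (simp add: trunc_scale_def assms(3,4) algebra_simps t2)
    then show ?thesis
      by (auto intro!: module_hom.intro module_hom_axioms.intro A.module_axioms M.module_axioms
          simp: assms(3) f.zero algebra_simps)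
  qed
  fix F assume F: "module_hom (trunc_scale s) sM F \<and> (\<forall>x. F (x, 0) = f x)"
  then interpret F: module_hom "trunc_scale s" sM F by blast
  show "F = (\<lambda>z. f (fst z) + sM trunc_t (f (snd z)))"
  proof
    fix z :: "'h \<times> 'h"
    have "z = (fst z, 0) + trunc_scale s trunc_t (snd z, 0)"
      by (simp add: trunc_scale_def prod_eq_iff)
    then have "F z = F (fst z, 0) + sM trunc_t (F (snd z, 0))"
      by (metis F.add F.scale)
    with F show "F z = f (fst z) + sM trunc_t (f (snd z))" by simp
  qed
qed

text \<open>The map from tensor powers of \<open>H\<close> over \<open>k\<close> to tensor powers of \<open>A\<close> over \<open>k[[t]]/(t\<^sup>2)\<close>
  induced by \<open>H \<subseteq> A\<close>.\<close>

definition trunc_incl ::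
    "('k::field \<Rightarrow> 'h::ab_group_add \<Rightarrow> 'h) \<Rightarrow> ('k, 'h) tensor \<Rightarrow> ('k trunc, 'h \<times> 'h) tensor" where
  "trunc_incl s X = (\<Union>u\<in>X. tcls (trunc_scale s)
     (\<Sum>xs\<in>Poly_Mapping.keys u.
        Poly_Mapping.single (map (\<lambda>x. (x, 0)) xs) (trunc_const (Poly_Mapping.lookup u xs))))"

text \<open>The \<open>k[[t]]/(t\<^sup>2)\<close>-linear extension of a \<open>k\<close>-linear map \<open>f\<close> from the \<open>m\<close>-th to the \<open>n\<close>-th
  tensor power of \<open>H\<close> to the tensor powers of \<open>A\<close>. It is unique because \<open>A\<close> is generated by \<open>H\<close> as a
  module. The structure maps of the Hopf algebra \<open>A\<close> are the extensions of those of \<open>H\<close>.\<close>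

definition trunc_ext ::
    "('k::field \<Rightarrow> 'h::ab_group_add \<Rightarrow> 'h) \<Rightarrow> nat \<Rightarrow> nat \<Rightarrow> (('k, 'h) tensor \<Rightarrow> ('k, 'h) tensor)
      \<Rightarrow> ('k trunc, 'h \<times> 'h) tensor \<Rightarrow> ('k trunc, 'h \<times> 'h) tensor" where
  "trunc_ext s m n f =
     (THE h. h \<in> tlinear (trunc_scale s) m n \<inter> extensional (tensor_power (trunc_scale s) m) \<and>
        (\<forall>X\<in>tensor_power s m. h (trunc_incl s X) = trunc_incl s (f X)))"

end

(*
With q = ad + t phi one has R(x, y) = y1 (x) q(x, y2) in Sweedler notation. Both sides of the
Yang-Baxter equation at x (x) y (x) z agree as soon as
  (1) q(q(x, y), z) = q(x, y z) and
  (2) q(x1, y1) (x) x2 y2 = q(x, y2)_1 (x) y1 q(x, y2)_2: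
by coassociativity and (1) the left side is z1 (x) q(y1, z2) (x) q(x, y2 z3), the right side is
z1 (x) q(y, z3)_1 (x) q(x, z2 q(y, z3)_2), and (2) identifies the two. Modulo t^2, the coefficient
of 1 in (1) and (2) is the statement for ad, which holds because the antipode reverses products and
coproducts, and the coefficient of t is the cocycle condition on phi.
Tensors are compared by evaluating multilinear maps on sums of pure tensors.
*)
theory Submission
  imports Defs
begin

section \<open>Linear extension from a free module\<close>

text \<open>Tensor powers are sets of cosets inside one type, not types with a group structure, so
  Sweedler sums cannot be rearranged there by the usual laws of finite sums. Identities are
  therefore pushed through multilinear maps into a module that is a type. The Hopf identities are
  proved for maps over \<open>k\<close> into an arbitrary module; choosing k[[t]]/(t^2), viewed as a
  module over \<open>k\<close>, as that target carries them over to \<open>A\<close>. That maps into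
  k[[t]]/(t^2) suffice to tell tensors over \<open>A\<close> apart is not automatic, as this ring is
  not a field; it is derived from linear functionals over \<open>k\<close>. A coproduct is
  represented by an arbitrarily chosen list of pairs, which is not additive in its argument; only
  its sums against bilinear maps are. Both \<open>tlift\<close> and \<open>trunc_ext\<close> are
  definite descriptions, so a map with the required properties has to be constructed and shown
  unique before either can be computed with. Since \<open>A\<close> is generated by
  \<open>H\<close>, both sides are compared only on entries from \<open>H\<close>; in (1) and (2)
  the product is then that of \<open>H\<close>.\<close>

definition flift :: "('r::comm_ring_1 \<Rightarrow> 'w::ab_group_add \<Rightarrow> 'w) \<Rightarrow> ('x \<Rightarrow> 'w) \<Rightarrow> ('x \<Rightarrow>\<^sub>0 'r) \<Rightarrow> 'w" where
  "flift sW F u = (\<Sum>x\<in>Poly_Mapping.keys u. sW (Poly_Mapping.lookup u x) (F x))"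

lemma lookup_fscale [simp]: "Poly_Mapping.lookup (fscale c u) x = c * Poly_Mapping.lookup u x"
  by (simp add: fscale_def Poly_Mapping.map.rep_eq when_def)

lemma fext_eq_flift: "fext P u = flift fscale P u"
  by (simp add: fext_def flift_def)

interpretation free: module "fscale :: 'r::comm_ring_1 \<Rightarrow> ('x \<Rightarrow>\<^sub>0 'r) \<Rightarrow> ('x \<Rightarrow>\<^sub>0 'r)"
  by unfold_locales (auto intro!: poly_mapping_eqI simp: lookup_add algebra_simps)

lemma fscale_single [simp]: "fscale c (Poly_Mapping.single x a) = Poly_Mapping.single x (c * a)"
  by (rule poly_mapping_eqI) (simp add: lookup_single when_def)

context module
begin

text \<open>Two elements and their sum have different supports; over a common finite superset, where
  the extra terms have coefficient 0, the sums become comparable.\<close>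

lemma flift_superset:
  assumes "finite K" "Poly_Mapping.keys u \<subseteq> K"
  shows "flift scale F u = (\<Sum>x\<in>K. scale (Poly_Mapping.lookup u x) (F x))"
  unfolding flift_def
  by (rule sum.mono_neutral_left) (use assms in \<open>auto simp: in_keys_iff\<close>)

lemma flift_add: "flift scale F (u + v) = flift scale F u + flift scale F v"
proof -
  let ?K = "Poly_Mapping.keys u \<union> Poly_Mapping.keys v"
  have "Poly_Mapping.keys (u + v) \<subseteq> ?K" by (rule Poly_Mapping.keys_add)
  then show ?thesis
    by (simp add: flift_superset[of ?K] lookup_add scale_left_distrib sum.distrib)
qed

lemma flift_fscale: "flift scale F (fscale c u) = scale c (flift scale F u)"
proof -
  have "Poly_Mapping.keys (fscale c u) \<subseteq> Poly_Mapping.keys u" by (auto simp: in_keys_iff)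
  then show ?thesis
    by (simp add: flift_superset[of "Poly_Mapping.keys u"] scale_sum_right)
qed

lemma flift_zero [simp]: "flift scale F 0 = 0"
  by (simp add: flift_def)

lemma flift_diff: "flift scale F (u - v) = flift scale F u - flift scale F v"
  by (metis add_diff_cancel diff_add_cancel flift_add)

lemma flift_single [simp]: "flift scale F (Poly_Mapping.single x c) = scale c (F x)"
  by (cases "c = 0") (simp_all add: flift_def)

lemma flift_fun_add: "flift scale (\<lambda>x. F x + G x) u = flift scale F u + flift scale G u"
  by (simp add: flift_def scale_right_distrib sum.distrib)

lemma flift_fun_diff: "flift scale (\<lambda>x. F x - G x) u = flift scale F u - flift scale G u"
  by (simp add: flift_def scale_right_diff_distrib sum_subtractf)

lemma flift_fun_scale: "flift scale (\<lambda>x. scale c (F x)) u = scale c (flift scale F u)"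
  by (simp add: flift_def scale_sum_right mult.commute)

lemma flift_in_subspace:
  assumes "subspace N" "\<And>x. x \<in> Poly_Mapping.keys u \<Longrightarrow> F x \<in> N"
  shows "flift scale F u \<in> N"
  unfolding flift_def by (intro subspace_sum[OF assms(1)] subspace_scale[OF assms(1)] assms(2))

end

lemma free_decomp: "u = (\<Sum>x\<in>Poly_Mapping.keys u. Poly_Mapping.single x (Poly_Mapping.lookup u x))"
  by (simp add: poly_mapping_eqI lookup_sum lookup_single when_def in_keys_iff)

section \<open>The tensor powers as modules\<close>

text \<open>Multilinearity modulo \<open>N\<close>. With \<open>N = {0}\<close> it is the ordinary
  notion; with \<open>N\<close> the relations of a target tensor power it covers maps given by
  chosen coset representatives, which are multilinear only up to relations.\<close>

definition mlin_mod :: "'w set \<Rightarrow> ('r::comm_ring_1 \<Rightarrow> 'm::ab_group_add \<Rightarrow> 'm)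
    \<Rightarrow> ('r \<Rightarrow> 'w::ab_group_add \<Rightarrow> 'w) \<Rightarrow> nat \<Rightarrow> ('m list \<Rightarrow> 'w) \<Rightarrow> bool" where
  "mlin_mod N s sW n F \<longleftrightarrow> (\<forall>xs ys x y c. length xs + length ys + 1 = n \<longrightarrow>
     F (xs @ (x + y) # ys) - F (xs @ x # ys) - F (xs @ y # ys) \<in> N \<and>
     F (xs @ s c x # ys) - sW c (F (xs @ x # ys)) \<in> N)"

locale tensor_module = module s for s :: "'r::comm_ring_1 \<Rightarrow> 'm::ab_group_add \<Rightarrow> 'm"
begin

lemma subspace_tensor_null: "free.subspace (tensor_null s)"
  by (simp add: tensor_null_def)

lemmas null_0 [simp] = free.subspace_0[OF subspace_tensor_null]
lemmas null_add = free.subspace_add[OF subspace_tensor_null]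
lemmas null_diff = free.subspace_diff[OF subspace_tensor_null]
lemmas null_scale = free.subspace_scale[OF subspace_tensor_null]

lemma flift_null_all:
  assumes W: "module sW" and N: "module.subspace sW N" and F: "\<And>n. mlin_mod N s sW n F"
    and u: "u \<in> tensor_null s"
  shows "flift sW F u \<in> N"
proof -
  interpret W: module sW by (rule W)
  show ?thesis
    using u unfolding tensor_null_def
  proof (induction rule: free.span_induct)
    case base
    show ?case
      by (auto simp: free.subspace_def W.flift_add W.flift_fscale W.subspace_0[OF N]
          intro: W.subspace_add[OF N] W.subspace_scale[OF N])
  next
    case (step v)
    then show ?case
      using F unfolding tensor_rels_def mlin_mod_def
      by (force simp: W.flift_diff W.subspace_0[OF N])
  qed
qed

text \<open>Each defining relation involves lists of one length only, so a map that is multilinear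
  in length \<open>n\<close> remains multilinear in every length when it is set to 0 on all other
  lists.\<close>

lemma flift_null:
  assumes W: "module sW" and N: "module.subspace sW N" and F: "mlin_mod N s sW n F"
    and u: "u \<in> tensor_null s"
  shows "flift sW (\<lambda>xs. if length xs = n then F xs else 0) u \<in> N"
proof (rule flift_null_all[OF W N _ u])
  interpret W: module sW by (rule W)
  show "mlin_mod N s sW m (\<lambda>xs. if length xs = n then F xs else 0)" for m
    using F by (auto simp: mlin_mod_def W.subspace_0[OF N])
qed

lemma tcls_eq_iff: "tcls s u = tcls s v \<longleftrightarrow> u - v \<in> tensor_null s"
proof
  assume "tcls s u = tcls s v"
  moreover have "u \<in> tcls s u" by (simp add: tcls_def)
  ultimately show "u - v \<in> tensor_null s" by (simp add: tcls_def)
next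
  assume *: "u - v \<in> tensor_null s"
  have "w - u \<in> tensor_null s \<longleftrightarrow> w - v \<in> tensor_null s" for w
    using null_add[OF _ *, of "w - u"] null_diff[OF _ *, of "w - v"] by (auto simp: algebra_simps)
  then show "tcls s u = tcls s v" by (simp add: tcls_def)
qed

lemma tcls_self: "u \<in> tcls s u" by (simp add: tcls_def)

lemma tcls_mem: "u \<in> tcls s v \<longleftrightarrow> tcls s u = tcls s v"
  by (simp add: tcls_eq_iff) (simp add: tcls_def)

text \<open>Operations on cosets are defined as unions over all representatives. Once the result is
  known not to depend on the representative, the union over the nonempty coset collapses to
  it.\<close>

lemma UN_tcls:
  assumes "\<And>w. tcls s w = tcls s u \<Longrightarrow> f w = A"
  shows "(\<Union>w\<in>tcls s u. f w) = A"
proof -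
  have "(\<Union>w\<in>tcls s u. f w) = (\<Union>w\<in>tcls s u. A)"
    by (rule SUP_cong) (simp_all add: assms tcls_mem)
  then show ?thesis using tcls_self by auto
qed

lemma tadd_tcls [simp]: "tadd s (tcls s u) (tcls s v) = tcls s (u + v)"
proof -
  have "tcls s (u' + v') = tcls s (u + v)" if "tcls s u' = tcls s u" "tcls s v' = tcls s v" for u' v'
    using that null_add[of "u' - u" "v' - v"] by (simp add: tcls_eq_iff algebra_simps)
  then show ?thesis unfolding tadd_def by (intro UN_tcls)
qed

lemma tdiff_tcls [simp]: "tdiff s (tcls s u) (tcls s v) = tcls s (u - v)"
proof -
  have "tcls s (u' - v') = tcls s (u - v)" if "tcls s u' = tcls s u" "tcls s v' = tcls s v" for u' v'
    using that null_diff[of "u' - u" "v' - v"] by (simp add: tcls_eq_iff algebra_simps)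
  then show ?thesis unfolding tdiff_def by (intro UN_tcls)
qed

lemma tscale_tcls [simp]: "tscale s c (tcls s u) = tcls s (fscale c u)"
proof -
  have "tcls s (fscale c u') = tcls s (fscale c u)" if "tcls s u' = tcls s u" for u'
    using that null_scale[of "u' - u" c] by (simp add: tcls_eq_iff free.scale_right_diff_distrib)
  then show ?thesis unfolding tscale_def by (intro UN_tcls)
qed

lemma rel_add_in_null:
  "Poly_Mapping.single (xs @ (x + y) # ys) 1 - Poly_Mapping.single (xs @ x # ys) 1
     - Poly_Mapping.single (xs @ y # ys) 1 \<in> tensor_null s"
  unfolding tensor_null_def by (rule free.span_base) (unfold tensor_rels_def, blast)

lemma rel_scale_in_null:
  "Poly_Mapping.single (xs @ s c x # ys) 1 - Poly_Mapping.single (xs @ x # ys) c \<in> tensor_null s"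
  unfolding tensor_null_def by (rule free.span_base) (unfold tensor_rels_def, blast)

section \<open>Concatenation of lists descends to the tensor product\<close>

lemma fconcat_eq: "fconcat u v = flift fscale (\<lambda>xs. flift fscale (\<lambda>ys. Poly_Mapping.single (xs @ ys) 1) v) u"
  by (simp add: fconcat_def fext_eq_flift)

lemma fconcat_add_left: "fconcat (u + u') v = fconcat u v + fconcat u' v"
  by (simp add: fconcat_eq free.flift_add)
lemma fconcat_add_right: "fconcat u (v + v') = fconcat u v + fconcat u v'"
  by (simp add: fconcat_eq free.flift_add free.flift_fun_add)
lemma fconcat_diff_left: "fconcat (u - u') v = fconcat u v - fconcat u' v"
  by (simp add: fconcat_eq free.flift_diff)
lemma fconcat_diff_right: "fconcat u (v - v') = fconcat u v - fconcat u v'"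
  by (simp add: fconcat_eq free.flift_diff free.flift_fun_diff)
lemma fconcat_scale_left: "fconcat (fscale c u) v = fscale c (fconcat u v)"
  by (simp add: fconcat_eq free.flift_fscale)
lemma fconcat_scale_right: "fconcat u (fscale c v) = fscale c (fconcat u v)"
  by (simp only: fconcat_eq free.flift_fscale free.flift_fun_scale)

lemma fconcat_single [simp]:
  "fconcat (Poly_Mapping.single xs a) (Poly_Mapping.single ys b) = Poly_Mapping.single (xs @ ys) (a * b)"
  by (simp add: fconcat_eq)

text \<open>Appending a fixed list to a defining relation yields a defining relation, so
  concatenating a relation with \<open>v\<close> gives a linear combination of relations.\<close>

lemma fconcat_null_left:
  assumes "u \<in> tensor_null s" shows "fconcat u v \<in> tensor_null s"
proof -
  let ?F = "\<lambda>xs. flift fscale (\<lambda>ys. Poly_Mapping.single (xs @ ys) 1) v"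
  show ?thesis
    using assms unfolding tensor_null_def
  proof (induction rule: free.span_induct)
    case base
    show ?case
      unfolding tensor_null_def[symmetric]
      by (auto simp: free.subspace_def fconcat_add_left fconcat_scale_left null_add null_scale)
        (simp add: fconcat_eq)
  next
    case (step w)
    then consider xs x y ys where "w = Poly_Mapping.single (xs @ (x + y) # ys) 1 -
        Poly_Mapping.single (xs @ x # ys) 1 - Poly_Mapping.single (xs @ y # ys) 1"
      | xs c x ys where "w = Poly_Mapping.single (xs @ s c x # ys) 1 - Poly_Mapping.single (xs @ x # ys) c"
      unfolding tensor_rels_def by blast
    then show ?case
      unfolding tensor_null_def[symmetric]
    proof cases
      case 1
      show "fconcat w v \<in> tensor_null s"
        unfolding 1 fconcat_diff_left
        unfolding fconcat_eq free.flift_single free.scale_one free.flift_fun_diff[symmetric]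
        by (rule free.flift_in_subspace[OF subspace_tensor_null]) (use rel_add_in_null in simp)
    next
      case 2
      show "fconcat w v \<in> tensor_null s"
        unfolding 2 fconcat_diff_left
        unfolding fconcat_eq free.flift_single free.scale_one free.flift_fun_scale[symmetric] free.flift_fun_diff[symmetric]
        by (rule free.flift_in_subspace[OF subspace_tensor_null]) (use rel_scale_in_null in simp)
    qed
  qed
qed

lemma fconcat_null_right:
  assumes "v \<in> tensor_null s" shows "fconcat u v \<in> tensor_null s"
proof -
  have "flift fscale (\<lambda>ys. Poly_Mapping.single (xs @ ys) 1) v \<in> tensor_null s" for xs
    using assms unfolding tensor_null_def
  proof (induction rule: free.span_induct)
    case base
    show ?case
      unfolding tensor_null_def[symmetric]
      by (auto simp: free.subspace_def free.flift_add free.flift_fscale null_add null_scale)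
  next
    case (step w)
    then show ?case
      unfolding tensor_null_def[symmetric] unfolding tensor_rels_def
      by (auto simp: free.flift_diff)
        (metis append.assoc rel_add_in_null rel_scale_in_null)+
  qed
  then show ?thesis
    unfolding fconcat_eq by (rule free.flift_in_subspace[OF subspace_tensor_null])
qed

lemma tmult_tcls [simp]: "tmult s (tcls s u) (tcls s v) = tcls s (fconcat u v)"
proof -
  have "tcls s (fconcat u' v') = tcls s (fconcat u v)" if "tcls s u' = tcls s u" "tcls s v' = tcls s v" for u' v'
  proof -
    have "fconcat u' v' - fconcat u v = fconcat (u' - u) v' + fconcat u (v' - v)"
      by (simp add: fconcat_diff_left fconcat_diff_right)
    then show ?thesis
      using that by (simp add: tcls_eq_iff null_add fconcat_null_left fconcat_null_right)
  qed
  then show ?thesis unfolding tmult_def by (intro UN_tcls)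
qed

section \<open>Homogeneous representatives and induction on tensors\<close>

definition hom_elts :: "nat \<Rightarrow> ('m list \<Rightarrow>\<^sub>0 'r) set" where
  "hom_elts n = {u. \<forall>xs\<in>Poly_Mapping.keys u. length xs = n}"

lemma tensor_power_eq: "tensor_power s n = tcls s ` hom_elts n"
  by (simp add: tensor_power_def hom_elts_def)

lemma subspace_hom_elts: "free.subspace (hom_elts n)"
proof -
  have "u + v \<in> hom_elts n" if "u \<in> hom_elts n" "v \<in> hom_elts n" for u v
    using that Poly_Mapping.keys_add[of u v] unfolding hom_elts_def by blast
  moreover have "fscale c u \<in> hom_elts n" if "u \<in> hom_elts n" for u c
  proof -
    have "Poly_Mapping.keys (fscale c u) \<subseteq> Poly_Mapping.keys u" by (auto simp: in_keys_iff)
    then show ?thesis using that unfolding hom_elts_def by blast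
  qed
  moreover have "0 \<in> hom_elts n" by (simp add: hom_elts_def)
  ultimately show ?thesis
    unfolding free.subspace_def by blast
qed

lemma fconcat_hom: "u \<in> hom_elts m \<Longrightarrow> v \<in> hom_elts n \<Longrightarrow> fconcat u v \<in> hom_elts (m + n)"
  unfolding fconcat_eq
  by (intro free.flift_in_subspace[OF subspace_hom_elts]) (auto simp: hom_elts_def)

lemma tcls_in_power: "u \<in> hom_elts n \<Longrightarrow> tcls s u \<in> tensor_power s n"
  by (simp add: tensor_power_eq)

lemma tpowerE:
  assumes "X \<in> tensor_power s n" obtains u where "X = tcls s u" "u \<in> hom_elts n"
  using assms by (auto simp: tensor_power_eq)

lemma single_hom [simp]: "length xs = n \<Longrightarrow> Poly_Mapping.single xs c \<in> hom_elts n"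
  by (simp add: hom_elts_def)

lemma pure_in [simp, intro]: "length xs = n \<Longrightarrow> pure_tensor s xs \<in> tensor_power s n"
  by (simp add: pure_tensor_def tcls_in_power)

lemma tzero_in [simp, intro]: "tzero s \<in> tensor_power s n"
  by (simp add: tzero_def tcls_in_power free.subspace_0[OF subspace_hom_elts])

lemma tadd_in [simp, intro]:
  "X \<in> tensor_power s n \<Longrightarrow> Y \<in> tensor_power s n \<Longrightarrow> tadd s X Y \<in> tensor_power s n"
  by (auto elim!: tpowerE intro!: tcls_in_power free.subspace_add[OF subspace_hom_elts])

lemma tscale_in [simp, intro]: "X \<in> tensor_power s n \<Longrightarrow> tscale s c X \<in> tensor_power s n"
  by (auto elim!: tpowerE intro!: tcls_in_power free.subspace_scale[OF subspace_hom_elts])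

lemma tmult_in: "X \<in> tensor_power s m \<Longrightarrow> Y \<in> tensor_power s n \<Longrightarrow> tmult s X Y \<in> tensor_power s (m + n)"
  by (auto elim!: tpowerE intro!: tcls_in_power fconcat_hom)

lemma tpower_induct [consumes 1, case_names zero pure add scale]:
  assumes X: "X \<in> tensor_power s n"
    and zero: "P (tzero s)"
    and pure: "\<And>xs. length xs = n \<Longrightarrow> P (pure_tensor s xs)"
    and add: "\<And>X Y. X \<in> tensor_power s n \<Longrightarrow> Y \<in> tensor_power s n \<Longrightarrow> P X \<Longrightarrow> P Y \<Longrightarrow> P (tadd s X Y)"
    and scale: "\<And>c X. X \<in> tensor_power s n \<Longrightarrow> P X \<Longrightarrow> P (tscale s c X)"
  shows "P X"
proof -
  obtain u where u: "X = tcls s u" "u \<in> hom_elts n" using X by (rule tpowerE)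
  \<comment> \<open>Homogeneity of the partial sums is carried along with \<open>P\<close>, because
    the hypothesis \<open>add\<close> applies only to members of the power.\<close>
  have "P (tcls s (\<Sum>xs\<in>K. Poly_Mapping.single xs (g xs))) \<and> (\<Sum>xs\<in>K. Poly_Mapping.single xs (g xs)) \<in> hom_elts n"
    if "finite K" "\<forall>xs\<in>K. length xs = n" for K and g :: "'m list \<Rightarrow> 'r"
    using that
  proof (induction K rule: finite_induct)
    case empty
    show ?case using zero by (simp add: tzero_def free.subspace_0[OF subspace_hom_elts])
  next
    case (insert xs K)
    have "P (tcls s (Poly_Mapping.single xs (g xs)))"
      using scale[of "pure_tensor s xs" "g xs"] pure[of xs] insert.prems by (auto simp: pure_tensor_def tcls_in_power)
    then show ?case
      using insert add[of "tcls s (Poly_Mapping.single xs (g xs))" "tcls s (\<Sum>xs\<in>K. Poly_Mapping.single xs (g xs))"]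
      by (auto simp: tcls_in_power intro!: free.subspace_add[OF subspace_hom_elts])
  qed
  from this[of "Poly_Mapping.keys u" "Poly_Mapping.lookup u"] show ?thesis
    using u free_decomp[of u] by (simp add: hom_elts_def)
qed

end

section \<open>Sums over lists of pairs\<close>

text \<open>A list of pairs \<open>(a\<^sub>i, b\<^sub>i)\<close> stands for \<open>\<Sum> a\<^sub>i \<otimes> b\<^sub>i\<close>; with the list representing \<open>\<Delta>(y)\<close>,
  \<open>lsum\<close> and \<open>tlsum\<close> are the sums of Sweedler notation.\<close>

definition lsum :: "('a \<times> 'b) list \<Rightarrow> ('a \<Rightarrow> 'b \<Rightarrow> 'w::ab_group_add) \<Rightarrow> 'w" where
  "lsum l F = (\<Sum>p\<leftarrow>l. F (fst p) (snd p))"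

definition tlsum :: "('r::comm_ring_1 \<Rightarrow> 'm::ab_group_add \<Rightarrow> 'm) \<Rightarrow> ('a \<times> 'b) list
    \<Rightarrow> ('a \<Rightarrow> 'b \<Rightarrow> ('r, 'm) tensor) \<Rightarrow> ('r, 'm) tensor" where
  "tlsum s l F = foldr (\<lambda>p. tadd s (F (fst p) (snd p))) l (tzero s)"

lemma lsum_Nil [simp]: "lsum [] F = 0" by (simp add: lsum_def)
lemma lsum_Cons [simp]: "lsum (p # l) F = F (fst p) (snd p) + lsum l F" by (simp add: lsum_def)
lemma tlsum_Nil [simp]: "tlsum s [] F = tzero s" by (simp add: tlsum_def)
lemma tlsum_Cons [simp]: "tlsum s (p # l) F = tadd s (F (fst p) (snd p)) (tlsum s l F)" by (simp add: tlsum_def)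

lemma lsum_add: "lsum l (\<lambda>a b. F a b + G a b) = lsum l F + lsum l G"
  by (induction l) (simp_all add: algebra_simps)

lemma lsum_zero [simp]: "lsum l (\<lambda>a b. 0) = 0"
  by (induction l) simp_all

lemma lsum_swap: "lsum l (\<lambda>a b. lsum l' (\<lambda>c d. F a b c d)) = lsum l' (\<lambda>c d. lsum l (\<lambda>a b. F a b c d))"
  by (induction l) (simp_all add: lsum_add)

lemma lsum_additive:
  assumes "\<And>x y. f (x + y) = f x + f y" shows "f (lsum l F) = lsum l (\<lambda>a b. f (F a b))"
proof -
  interpret additive f by standard fact
  show ?thesis by (induction l) (simp_all add: zero add)
qed

lemma (in module) lsum_scale: "lsum l (\<lambda>a b. scale c (F a b)) = scale c (lsum l F)"
  by (rule lsum_additive[symmetric]) (rule scale_right_distrib)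

definition lin where
  "lin s sW f \<longleftrightarrow> (\<forall>x y. f (x + y) = f x + f y) \<and> (\<forall>c x. f (s c x) = sW c (f x))"

definition bilin where
  "bilin s sW F \<longleftrightarrow> (\<forall>y. lin s sW (\<lambda>x. F x y)) \<and> (\<forall>x. lin s sW (\<lambda>y. F x y))"

definition trilin where
  "trilin s sW F \<longleftrightarrow> (\<forall>y z. lin s sW (\<lambda>x. F x y z)) \<and> (\<forall>x z. lin s sW (\<lambda>y. F x y z))
     \<and> (\<forall>x y. lin s sW (\<lambda>z. F x y z))"

abbreviation mlin where "mlin \<equiv> mlin_mod {0}"

lemma mlin_iff: "mlin s sW n F \<longleftrightarrow> (\<forall>xs ys x y c. length xs + length ys + 1 = n \<longrightarrow>
     F (xs @ (x + y) # ys) = F (xs @ x # ys) + F (xs @ y # ys) \<and>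
     F (xs @ s c x # ys) = sW c (F (xs @ x # ys)))"
  by (simp add: mlin_mod_def algebra_simps)

lemma mlin_2: "bilin s sW F \<Longrightarrow> mlin s sW 2 (\<lambda>xs. F (xs ! 0) (xs ! 1))"
  apply (simp add: mlin_iff, intro allI impI)
  subgoal for xs ys
    by (cases xs rule: list.exhaust; cases "tl xs") (auto simp: bilin_def lin_def length_Suc_conv)
  done

lemma mlin_3: "trilin s sW F \<Longrightarrow> mlin s sW 3 (\<lambda>xs. F (xs ! 0) (xs ! 1) (xs ! 2))"
  apply (simp add: mlin_iff, intro allI impI)
  subgoal for xs ys
    by (cases xs rule: list.exhaust; cases "tl xs"; cases "tl (tl xs)")
      (auto simp: trilin_def lin_def eval_nat_numeral length_Suc_conv)
  done

section \<open>Linear maps between tensor powers\<close>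

context tensor_module
begin

lemma tadd_assoc_in:
  "X \<in> tensor_power s n \<Longrightarrow> Y \<in> tensor_power s n \<Longrightarrow> Z \<in> tensor_power s n
    \<Longrightarrow> tadd s (tadd s X Y) Z = tadd s X (tadd s Y Z)"
  by (auto elim!: tpowerE simp: algebra_simps)

lemma tadd_tzero [simp]: "X \<in> tensor_power s n \<Longrightarrow> tadd s (tzero s) X = X"
  by (auto elim!: tpowerE simp: tzero_def)

lemma tadd_tzero_right [simp]: "X \<in> tensor_power s n \<Longrightarrow> tadd s X (tzero s) = X"
  by (auto elim!: tpowerE simp: tzero_def)

lemma tscale_zero: "X \<in> tensor_power s n \<Longrightarrow> tscale s 0 X = tzero s"
  by (auto elim!: tpowerE simp: tzero_def)

lemma tscale_tzero [simp]: "tscale s c (tzero s) = tzero s"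
  by (simp add: tzero_def)

lemma tscale_tadd: "X \<in> tensor_power s n \<Longrightarrow> Y \<in> tensor_power s n
    \<Longrightarrow> tscale s c (tadd s X Y) = tadd s (tscale s c X) (tscale s c Y)"
  by (auto elim!: tpowerE simp: free.scale_right_distrib)

lemma tdiff_eq_tzero_iff: "X \<in> tensor_power s n \<Longrightarrow> Y \<in> tensor_power s n \<Longrightarrow> tdiff s X Y = tzero s \<longleftrightarrow> X = Y"
  by (elim tpowerE) (simp add: tzero_def tcls_eq_iff)

text \<open>Membership in \<open>range (tcls s)\<close> says only that a set is a coset, of whatever
  degree. This is enough for the bilinearity of \<open>tmult\<close>, so degrees need not be tracked
  there.\<close>

lemma tensor_range: "X \<in> tensor_power s n \<Longrightarrow> X \<in> range (tcls s)"
  by (auto simp: tensor_power_def)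

lemma range_pure [simp]: "pure_tensor s xs \<in> range (tcls s)"
  by (simp add: pure_tensor_def)

lemma range_tadd [simp]: "X \<in> range (tcls s) \<Longrightarrow> Y \<in> range (tcls s) \<Longrightarrow> tadd s X Y \<in> range (tcls s)"
  by auto

lemma range_tzero [simp]: "tzero s \<in> range (tcls s)"
  by (simp add: tzero_def)

lemma range_tlsum [simp]: "(\<And>a b. F a b \<in> range (tcls s)) \<Longrightarrow> tlsum s l F \<in> range (tcls s)"
  by (induction l) simp_all

lemma tmult_tadd_left: "X \<in> range (tcls s) \<Longrightarrow> Y \<in> range (tcls s) \<Longrightarrow> Z \<in> range (tcls s)
    \<Longrightarrow> tmult s (tadd s X Y) Z = tadd s (tmult s X Z) (tmult s Y Z)"
  by (auto simp: fconcat_add_left)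

lemma tmult_tadd_right: "X \<in> range (tcls s) \<Longrightarrow> Y \<in> range (tcls s) \<Longrightarrow> Z \<in> range (tcls s)
    \<Longrightarrow> tmult s Z (tadd s X Y) = tadd s (tmult s Z X) (tmult s Z Y)"
  by (auto simp: fconcat_add_right)

lemma tmult_tscale_left: "X \<in> range (tcls s) \<Longrightarrow> Z \<in> range (tcls s)
    \<Longrightarrow> tmult s (tscale s c X) Z = tscale s c (tmult s X Z)"
  by (auto simp: fconcat_scale_left)

lemma tmult_tscale_right: "X \<in> range (tcls s) \<Longrightarrow> Z \<in> range (tcls s)
    \<Longrightarrow> tmult s Z (tscale s c X) = tscale s c (tmult s Z X)"
  by (auto simp: fconcat_scale_right)

lemma tmult_tzero [simp]:
  "X \<in> range (tcls s) \<Longrightarrow> tmult s (tzero s) X = tzero s"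
  "X \<in> range (tcls s) \<Longrightarrow> tmult s X (tzero s) = tzero s"
  by (auto simp: tzero_def fconcat_eq flift_def)

lemma tmult_pure [simp]: "tmult s (pure_tensor s xs) (pure_tensor s ys) = pure_tensor s (xs @ ys)"
  by (simp add: pure_tensor_def)

lemma pure_add: "pure_tensor s (xs @ (x + y) # ys) = tadd s (pure_tensor s (xs @ x # ys)) (pure_tensor s (xs @ y # ys))"
  using rel_add_in_null by (simp add: pure_tensor_def tcls_eq_iff algebra_simps)

lemma pure_scale: "pure_tensor s (xs @ s c x # ys) = tscale s c (pure_tensor s (xs @ x # ys))"
  using rel_scale_in_null by (simp add: pure_tensor_def tcls_eq_iff)

lemma tlinear_in: "f \<in> tlinear s m n \<Longrightarrow> X \<in> tensor_power s m \<Longrightarrow> f X \<in> tensor_power s n"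
  by (auto simp: tlinear_def)

lemma tlinear_add: "f \<in> tlinear s m n \<Longrightarrow> X \<in> tensor_power s m \<Longrightarrow> Y \<in> tensor_power s m
    \<Longrightarrow> f (tadd s X Y) = tadd s (f X) (f Y)"
  by (auto simp: tlinear_def)

lemma tlinear_scale: "f \<in> tlinear s m n \<Longrightarrow> X \<in> tensor_power s m \<Longrightarrow> f (tscale s c X) = tscale s c (f X)"
  by (auto simp: tlinear_def)

lemma tlinear_zero: "f \<in> tlinear s m n \<Longrightarrow> f (tzero s) = tzero s"
  by (metis tlinear_scale tlinear_in tscale_zero tzero_in)

lemma tlsum_in [simp]: "(\<And>a b. F a b \<in> tensor_power s n) \<Longrightarrow> tlsum s l F \<in> tensor_power s n"
  by (induction l) auto

lemma tlinear_tlsum: "f \<in> tlinear s m n \<Longrightarrow> (\<And>a b. F a b \<in> tensor_power s m)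
    \<Longrightarrow> f (tlsum s l F) = tlsum s l (\<lambda>a b. f (F a b))"
  by (induction l) (simp_all add: tlinear_zero tlinear_add)

lemma tmult_tlsum_left: "(\<And>a b. F a b \<in> range (tcls s)) \<Longrightarrow> Y \<in> range (tcls s)
    \<Longrightarrow> tmult s (tlsum s l F) Y = tlsum s l (\<lambda>a b. tmult s (F a b) Y)"
  by (induction l) (simp_all add: tmult_tadd_left)

lemma tmult_tlsum_right: "(\<And>a b. F a b \<in> range (tcls s)) \<Longrightarrow> Y \<in> range (tcls s)
    \<Longrightarrow> tmult s Y (tlsum s l F) = tlsum s l (\<lambda>a b. tmult s Y (F a b))"
  by (induction l) (simp_all add: tmult_tadd_right)

lemma tlinear_eqI:
  assumes "f \<in> tlinear s m n" "g \<in> tlinear s m n" "X \<in> tensor_power s m"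
    and "\<And>xs. length xs = m \<Longrightarrow> f (pure_tensor s xs) = g (pure_tensor s xs)"
  shows "f X = g X"
  using assms(3)
  by (induction rule: tpower_induct)
    (use assms(1,2,4) in \<open>simp_all add: tlinear_zero[OF assms(1)] tlinear_zero[OF assms(2)]
      tlinear_add[OF assms(1)] tlinear_add[OF assms(2)] tlinear_scale[OF assms(1)] tlinear_scale[OF assms(2)]\<close>)

lemma tlinear_comp: "g \<in> tlinear s m n \<Longrightarrow> f \<in> tlinear s n k \<Longrightarrow> (\<lambda>X. f (g X)) \<in> tlinear s m k"
  by (auto simp: tlinear_def Pi_iff)

lemma id_tlinear: "id \<in> tlinear s m m"
  by (auto simp: tlinear_def)

definition tmultilin :: "nat \<Rightarrow> nat \<Rightarrow> ('m list \<Rightarrow> ('r, 'm) tensor) \<Rightarrow> bool" where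
  "tmultilin m n F \<longleftrightarrow> (\<forall>xs. length xs = m \<longrightarrow> F xs \<in> tensor_power s n) \<and>
     (\<forall>xs ys x y c. length xs + length ys + 1 = m \<longrightarrow>
        F (xs @ (x + y) # ys) = tadd s (F (xs @ x # ys)) (F (xs @ y # ys)) \<and>
        F (xs @ s c x # ys) = tscale s c (F (xs @ x # ys)))"

text \<open>Choosing a homogeneous representative \<open>r xs\<close> of each \<open>F xs\<close>
  gives a map that is multilinear modulo relations, hence its linear extension preserves relations
  and descends to cosets. Uniqueness holds because pure tensors generate and extensionality fixes
  the values elsewhere.\<close>

lemma tlift_props:
  assumes F: "tmultilin m n F"
  shows "tlift s m n F \<in> tlinear s m n \<inter> extensional (tensor_power s m) \<and>
     (\<forall>xs. length xs = m \<longrightarrow> tlift s m n F (pure_tensor s xs) = F xs)"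
proof -
  define r where "r xs = (SOME u. F xs = tcls s u \<and> u \<in> hom_elts n)" for xs
  have r: "F xs = tcls s (r xs)" "r xs \<in> hom_elts n" if "length xs = m" for xs
  proof -
    have "F xs \<in> tensor_power s n" using F that by (simp add: tmultilin_def)
    then have "\<exists>u. F xs = tcls s u \<and> u \<in> hom_elts n" by (rule tpowerE) blast
    from someI_ex[OF this] show "F xs = tcls s (r xs)" "r xs \<in> hom_elts n" by (auto simp: r_def)
  qed
  define r' where "r' xs = (if length xs = m then r xs else 0)" for xs
  have "mlin_mod (tensor_null s) s fscale m r"
    unfolding mlin_mod_def
  proof (intro allI impI conjI)
    fix xs ys :: "'m list" and x y c
    assume l: "length xs + length ys + 1 = m"
    have "tcls s (r (xs @ (x + y) # ys)) = tadd s (tcls s (r (xs @ x # ys))) (tcls s (r (xs @ y # ys)))"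
      using F l by (simp add: r(1)[symmetric] tmultilin_def del: tadd_tcls)
    then show "r (xs @ (x + y) # ys) - r (xs @ x # ys) - r (xs @ y # ys) \<in> tensor_null s"
      by (simp add: tcls_eq_iff diff_diff_eq)
    have "tcls s (r (xs @ s c x # ys)) = tscale s c (tcls s (r (xs @ x # ys)))"
      using F l by (simp add: r(1)[symmetric] tmultilin_def del: tscale_tcls)
    then show "r (xs @ s c x # ys) - fscale c (r (xs @ x # ys)) \<in> tensor_null s"
      by (simp add: tcls_eq_iff)
  qed
  then have null: "flift fscale r' u \<in> tensor_null s" if "u \<in> tensor_null s" for u
    unfolding r'_def using that by (intro flift_null[OF free.module_axioms subspace_tensor_null])
  \<comment> \<open>The representative picked by \<open>SOME\<close> may contain lists of other
    lengths; \<open>r'\<close> vanishes on them. The value \<open>undefined\<close> outside the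
    power makes \<open>h\<close> extensional.\<close>
  define h where "h X = (if X \<in> tensor_power s m then tcls s (flift fscale r' (SOME u. X = tcls s u)) else undefined)" for X
  have h: "h (tcls s u) = tcls s (flift fscale r' u)" if "u \<in> hom_elts m" for u
  proof -
    have "tcls s u = tcls s (SOME v. tcls s u = tcls s v)" by (rule someI[of _ u]) simp
    then have "flift fscale r' (SOME v. tcls s u = tcls s v) - flift fscale r' u \<in> tensor_null s"
      unfolding free.flift_diff[symmetric] by (intro null) (simp add: tcls_eq_iff[symmetric])
    then show ?thesis using tcls_in_power[OF that] by (simp add: h_def tcls_eq_iff)
  qed
  have r'_hom: "flift fscale r' u \<in> hom_elts n" if "u \<in> hom_elts m" for u
    by (rule free.flift_in_subspace[OF subspace_hom_elts]) (simp add: r'_def r(2) free.subspace_0[OF subspace_hom_elts])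
  have "h \<in> tlinear s m n"
    unfolding tlinear_def
    by (auto elim!: tpowerE simp: h r'_hom tcls_in_power free.flift_add free.flift_fscale
        free.subspace_add[OF subspace_hom_elts] free.subspace_scale[OF subspace_hom_elts])
  moreover have "h \<in> extensional (tensor_power s m)" by (simp add: h_def extensional_def)
  moreover have hp: "h (pure_tensor s xs) = F xs" if "length xs = m" for xs
    using that by (simp add: pure_tensor_def h r'_def r(1))
  ultimately have hP: "h \<in> tlinear s m n \<inter> extensional (tensor_power s m) \<and>
     (\<forall>xs. length xs = m \<longrightarrow> h (pure_tensor s xs) = F xs)" by blast
  have "tlift s m n F = h"
    unfolding tlift_def
  proof (rule the_equality)
    fix h'
    assume h': "h' \<in> tlinear s m n \<inter> extensional (tensor_power s m) \<and>
     (\<forall>xs. length xs = m \<longrightarrow> h' (pure_tensor s xs) = F xs)"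
    show "h' = h"
    proof
      fix X
      show "h' X = h X"
      proof (cases "X \<in> tensor_power s m")
        case True
        with h' hP show ?thesis by (intro tlinear_eqI[of h' m n h X]) simp_all
      next
        case False
        with h' show ?thesis by (simp add: h_def extensional_def)
      qed
    qed
  qed (rule hP)
  with hP show ?thesis by simp
qed

lemma tlift_tlinear: "tmultilin m n F \<Longrightarrow> tlift s m n F \<in> tlinear s m n"
  using tlift_props by blast

lemma tlift_pure: "tmultilin m n F \<Longrightarrow> length xs = m \<Longrightarrow> tlift s m n F (pure_tensor s xs) = F xs"
  using tlift_props by blast

section \<open>Tensor products of linear maps and the flip\<close>

lemma tmultilin_tmap:
  assumes f: "f \<in> tlinear s m k" and g: "g \<in> tlinear s p q"
  shows "tmultilin (m + p) (k + q) (\<lambda>xs. tmult s (f (pure_tensor s (take m xs))) (g (pure_tensor s (drop m xs))))"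
  unfolding tmultilin_def
proof (intro allI impI conjI)
  fix xs :: "'m list"
  assume "length xs = m + p"
  then show "tmult s (f (pure_tensor s (take m xs))) (g (pure_tensor s (drop m xs))) \<in> tensor_power s (k + q)"
    by (intro tmult_in tlinear_in[OF f] tlinear_in[OF g]) auto
next
  fix xs ys :: "'m list" and x y c
  assume l: "length xs + length ys + 1 = m + p"
  let ?F = "\<lambda>xs. tmult s (f (pure_tensor s (take m xs))) (g (pure_tensor s (drop m xs)))"
  have "?F (xs @ (x + y) # ys) = tadd s (?F (xs @ x # ys)) (?F (xs @ y # ys)) \<and>
        ?F (xs @ s c x # ys) = tscale s c (?F (xs @ x # ys))"
  proof (cases "length xs < m")
    case True
    \<comment> \<open>The varied entry itself occupies one of the first \<open>m\<close> slots, so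
      \<open>k\<close> counts the entries of \<open>ys\<close> that still belong to
      \<open>f\<close>.\<close>
    then obtain k where k: "m = length xs + Suc k" by (metis less_imp_Suc_add add_Suc_right)
    let ?ys = "take k ys" and ?zs = "drop k ys"
    have td: "take m (xs @ z # ys) = xs @ z # ?ys" "drop m (xs @ z # ys) = ?zs" for z
      by (simp_all add: k)
    have in1: "pure_tensor s (xs @ z # ?ys) \<in> tensor_power s m" for z
      using k l by (intro pure_in) simp
    have in2: "g (pure_tensor s ?zs) \<in> tensor_power s q"
      using k l by (intro tlinear_in[OF g] pure_in) simp
    show ?thesis
      unfolding td pure_add pure_scale
      by (simp only: tlinear_add[OF f in1 in1] tlinear_scale[OF f in1]
          tmult_tadd_left[OF tensor_range[OF tlinear_in[OF f in1]] tensor_range[OF tlinear_in[OF f in1]] tensor_range[OF in2]]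
          tmult_tscale_left[OF tensor_range[OF tlinear_in[OF f in1]] tensor_range[OF in2]])
  next
    case False
    let ?ys = "drop m xs"
    have td: "take m (xs @ z # ys) = take m xs" "drop m (xs @ z # ys) = ?ys @ z # ys" for z
      using False by auto
    have in1: "pure_tensor s (?ys @ z # ys) \<in> tensor_power s p" for z
      using False l by (intro pure_in) simp
    have in2: "f (pure_tensor s (take m xs)) \<in> tensor_power s k"
      using False l by (intro tlinear_in[OF f] pure_in) simp
    show ?thesis
      unfolding td pure_add pure_scale
      by (simp only: tlinear_add[OF g in1 in1] tlinear_scale[OF g in1]
          tmult_tadd_right[OF tensor_range[OF tlinear_in[OF g in1]] tensor_range[OF tlinear_in[OF g in1]] tensor_range[OF in2]]
          tmult_tscale_right[OF tensor_range[OF tlinear_in[OF g in1]] tensor_range[OF in2]])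
  qed
  then show "?F (xs @ (x + y) # ys) = tadd s (?F (xs @ x # ys)) (?F (xs @ y # ys))"
     "?F (xs @ s c x # ys) = tscale s c (?F (xs @ x # ys))" by auto
qed

lemma tmap_tlinear:
  assumes "f \<in> tlinear s m k" "g \<in> tlinear s p q" "M = m + p" "N = k + q"
  shows "tmap s (m, k) f (p, q) g \<in> tlinear s M N"
  unfolding tmap_def using tlift_tlinear[OF tmultilin_tmap[OF assms(1,2)]] assms(3,4) by simp

lemma tmap_pure:
  assumes "f \<in> tlinear s m k" "g \<in> tlinear s p q" "length xs = m + p"
  shows "tmap s (m, k) f (p, q) g (pure_tensor s xs) =
    tmult s (f (pure_tensor s (take m xs))) (g (pure_tensor s (drop m xs)))"
  unfolding tmap_def using tlift_pure[OF tmultilin_tmap[OF assms(1,2)] assms(3)] by simp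

lemma tmap_tlsum:
  assumes "f \<in> tlinear s m k" "g \<in> tlinear s p q" "\<And>a b. F a b \<in> tensor_power s (m + p)"
  shows "tmap s (m, k) f (p, q) g (tlsum s l F) = tlsum s l (\<lambda>a b. tmap s (m, k) f (p, q) g (F a b))"
  by (rule tlinear_tlsum[OF tmap_tlinear[OF assms(1,2) refl refl] assms(3)])

lemma tmultilin_rev: "tmultilin n n (\<lambda>xs. pure_tensor s (rev xs))"
  by (auto simp: tmultilin_def pure_add pure_scale)

lemma tflip_tlinear: "tflip s \<in> tlinear s 2 2"
  unfolding tflip_def by (rule tlift_tlinear[OF tmultilin_rev])

lemma tflip_pure: "tflip s (pure_tensor s [x, y]) = pure_tensor s [y, x]"
  unfolding tflip_def by (subst tlift_pure[OF tmultilin_rev]) simp_all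

section \<open>Evaluation of multilinear maps\<close>

text \<open>The linear map induced by a multilinear \<open>\<psi>\<close> with values in a module
  that is a type, where \<open>tlift\<close> only produces maps into tensor powers. Setting
  \<open>\<psi>\<close> to 0 on other lengths makes the value independent of the chosen, possibly
  inhomogeneous, representative.\<close>

definition teval :: "('r \<Rightarrow> 'w::ab_group_add \<Rightarrow> 'w) \<Rightarrow> nat \<Rightarrow> ('m list \<Rightarrow> 'w) \<Rightarrow> ('r, 'm) tensor \<Rightarrow> 'w" where
  "teval sW n \<psi> X = flift sW (\<lambda>xs. if length xs = n then \<psi> xs else 0) (SOME u. u \<in> X)"

lemma teval_tcls:
  assumes W: "module sW" and \<psi>: "mlin s sW n \<psi>"
  shows "teval sW n \<psi> (tcls s u) = flift sW (\<lambda>xs. if length xs = n then \<psi> xs else 0) u"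
proof -
  interpret W: module sW by (rule W)
  have "(SOME v. v \<in> tcls s u) \<in> tcls s u" by (rule someI) (rule tcls_self)
  then have "(SOME v. v \<in> tcls s u) - u \<in> tensor_null s" by (simp add: tcls_mem tcls_eq_iff)
  from flift_null[OF W _ \<psi> this] show ?thesis
    unfolding teval_def by (simp add: W.flift_diff)
qed

lemma teval_pure [simp]:
  assumes "module sW" "mlin s sW n \<psi>" "length xs = n"
  shows "teval sW n \<psi> (pure_tensor s xs) = \<psi> xs"
proof -
  interpret W: module sW by fact
  show ?thesis using assms by (simp add: pure_tensor_def teval_tcls)
qed

lemma teval_tadd:
  assumes "module sW" "mlin s sW n \<psi>" "X \<in> tensor_power s m" "Y \<in> tensor_power s m"
  shows "teval sW n \<psi> (tadd s X Y) = teval sW n \<psi> X + teval sW n \<psi> Y"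
proof -
  interpret W: module sW by fact
  show ?thesis using assms(3,4) by (auto elim!: tpowerE simp: teval_tcls[OF assms(1,2)] W.flift_add)
qed

lemma teval_tscale:
  assumes "module sW" "mlin s sW n \<psi>" "X \<in> tensor_power s m"
  shows "teval sW n \<psi> (tscale s c X) = sW c (teval sW n \<psi> X)"
proof -
  interpret W: module sW by fact
  show ?thesis using assms(3) by (auto elim!: tpowerE simp: teval_tcls[OF assms(1,2)] W.flift_fscale)
qed

lemma teval_tzero:
  assumes "module sW" "mlin s sW n \<psi>"
  shows "teval sW n \<psi> (tzero s) = 0"
proof -
  interpret W: module sW by fact
  show ?thesis by (simp add: tzero_def teval_tcls[OF assms])
qed

lemma teval_tlsum:
  assumes "module sW" "mlin s sW n \<psi>" "\<And>a b. F a b \<in> tensor_power s m"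
  shows "teval sW n \<psi> (tlsum s l F) = lsum l (\<lambda>a b. teval sW n \<psi> (F a b))"
  by (induction l) (simp_all add: assms teval_tzero teval_tadd[where m = m])

section \<open>Tensor powers of small degree\<close>

text \<open>Evaluating \<open>hd\<close> inverts x \<mapsto> [x]; this is how elements of the module
  are read off from tensors of degree one.\<close>

lemma mlin_hd: "mlin s s 1 hd"
  by (simp add: mlin_iff)

lemma tscale_pure_Cons: "tscale s c (pure_tensor s (x # xs)) = pure_tensor s (s c x # xs)"
  using pure_scale[of "[]"] by simp

lemma tadd_pure_1: "tadd s (pure_tensor s [x]) (pure_tensor s [y]) = pure_tensor s [x + y]"
  using pure_add[of "[]"] by simp

lemma teval_hd_pure [simp]: "teval s 1 hd (pure_tensor s [x]) = x"
  by (rule trans[OF teval_pure[OF module_axioms mlin_hd]]) simp_all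

lemma pure_1_inject [simp]: "pure_tensor s [x] = pure_tensor s [y] \<longleftrightarrow> x = y"
  by (metis teval_hd_pure)

lemma tzero_pure_1: "tzero s = pure_tensor s [0]"
  using tscale_zero[of "pure_tensor s [0]" 1] by (simp add: tscale_pure_Cons)

lemma tlsum_pure_1: "tlsum s l (\<lambda>a b. pure_tensor s [F a b]) = pure_tensor s [lsum l F]"
  by (induction l) (simp_all add: tzero_pure_1 tadd_pure_1)

lemma tpower_1E:
  assumes "X \<in> tensor_power s 1" obtains x where "X = pure_tensor s [x]"
proof -
  from assms have "\<exists>x. X = pure_tensor s [x]"
    by (induction rule: tpower_induct)
      (auto simp: tzero_pure_1 tadd_pure_1 tscale_pure_Cons length_Suc_conv)
  then show ?thesis using that by blast
qed

lemma tpower_0E: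
  assumes "X \<in> tensor_power s 0" obtains c where "X = tscale s c (pure_tensor s [])"
proof -
  from assms have "\<exists>c. X = tscale s c (pure_tensor s [])"
  proof (induction rule: tpower_induct)
    case zero then show ?case using tscale_zero[of "pure_tensor s []" 0] by (metis length_0_conv pure_in)
  next
    case (pure xs) then show ?case by (auto intro!: exI[of _ 1] simp: pure_tensor_def)
  next
    case (add X Y)
    then obtain c d where "X = tscale s c (pure_tensor s [])" "Y = tscale s d (pure_tensor s [])" by blast
    then show ?case by (intro exI[of _ "c + d"]) (simp add: pure_tensor_def single_add)
  next
    case (scale c X)
    then obtain d where "X = tscale s d (pure_tensor s [])" by blast
    then show ?case by (intro exI[of _ "c * d"]) (simp add: pure_tensor_def)
  qed
  then show ?thesis using that by blast
qed

lemma tlsum_append: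
  "(\<And>a b. F a b \<in> tensor_power s n) \<Longrightarrow> tlsum s (l @ l') F = tadd s (tlsum s l F) (tlsum s l' F)"
  by (induction l) (simp_all add: tadd_assoc_in[where n = n] tadd_tzero[where n = n])

lemma tpower_2_lsum:
  assumes "X \<in> tensor_power s 2" shows "\<exists>l. X = tlsum s l (\<lambda>a b. pure_tensor s [a, b])"
  using assms
proof (induction rule: tpower_induct)
  case zero
  show ?case by (rule exI[of _ "[]"]) simp
next
  case (pure xs)
  then obtain x y where "xs = [x, y]" by (auto simp: length_Suc_conv eval_nat_numeral)
  moreover have "tadd s (pure_tensor s [x, y]) (tzero s) = pure_tensor s [x, y]"
    by (simp add: pure_tensor_def tzero_def)
  ultimately show ?case by (intro exI[of _ "[(x, y)]"]) simp
next
  case (add X Y)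
  then obtain l l' where "X = tlsum s l (\<lambda>a b. pure_tensor s [a, b])" "Y = tlsum s l' (\<lambda>a b. pure_tensor s [a, b])" by blast
  then show ?case by (intro exI[of _ "l @ l'"]) (simp add: tlsum_append[where n = 2])
next
  case (scale c X)
  then obtain l where l: "X = tlsum s l (\<lambda>a b. pure_tensor s [a, b])" by blast
  have "tscale s c (tlsum s l (\<lambda>a b. pure_tensor s [a, b])) =
    tlsum s (map (\<lambda>p. (s c (fst p), snd p)) l) (\<lambda>a b. pure_tensor s [a, b])"
    by (induction l) (simp_all add: tscale_tadd[where n = 2] tscale_pure_Cons)
  then show ?case unfolding l by blast
qed

section \<open>Structure maps as operations on elements\<close>

definition fun1 :: "(('r, 'm) tensor \<Rightarrow> ('r, 'm) tensor) \<Rightarrow> 'm \<Rightarrow> 'm" where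
  "fun1 f x = teval s 1 hd (f (pure_tensor s [x]))"

definition fun2 :: "(('r, 'm) tensor \<Rightarrow> ('r, 'm) tensor) \<Rightarrow> 'm \<Rightarrow> 'm \<Rightarrow> 'm" where
  "fun2 f x y = teval s 1 hd (f (pure_tensor s [x, y]))"

text \<open>A chosen list of Sweedler components. It is neither canonical nor additive in
  \<open>x\<close>, so it is only ever used inside sums against multilinear maps.\<close>

definition cop :: "(('r, 'm) tensor \<Rightarrow> ('r, 'm) tensor) \<Rightarrow> 'm \<Rightarrow> ('m \<times> 'm) list" where
  "cop \<Delta> x = (SOME l. \<Delta> (pure_tensor s [x]) = tlsum s l (\<lambda>a b. pure_tensor s [a, b]))"

lemma fun1: "f \<in> tlinear s 1 1 \<Longrightarrow> f (pure_tensor s [x]) = pure_tensor s [fun1 f x]"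
  unfolding fun1_def
  by (rule tpower_1E[of "f (pure_tensor s [x])"])
    (auto simp del: One_nat_def intro: tlinear_in)

lemma fun2: "f \<in> tlinear s 2 1 \<Longrightarrow> f (pure_tensor s [x, y]) = pure_tensor s [fun2 f x y]"
  unfolding fun2_def
  by (rule tpower_1E[of "f (pure_tensor s [x, y])"])
    (auto simp del: One_nat_def intro: tlinear_in)

lemma cop: "\<Delta> \<in> tlinear s 1 2 \<Longrightarrow> \<Delta> (pure_tensor s [x]) = tlsum s (cop \<Delta> x) (\<lambda>a b. pure_tensor s [a, b])"
  unfolding cop_def by (rule someI_ex, rule tpower_2_lsum) (auto intro: tlinear_in)

lemma fun2_eqI: "f (pure_tensor s [x, y]) = pure_tensor s [z] \<Longrightarrow> fun2 f x y = z"
  by (simp add: fun2_def del: One_nat_def)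

lemma lin_fun1:
  assumes f: "f \<in> tlinear s 1 1" shows "lin s s (fun1 f)"
proof -
  have "pure_tensor s [fun1 f (x + y)] = pure_tensor s [fun1 f x + fun1 f y]" for x y
    by (simp only: fun1[OF f, symmetric] tadd_pure_1[symmetric] tlinear_add[OF f pure_in pure_in] length_Cons list.size)
  moreover have "pure_tensor s [fun1 f (s c x)] = pure_tensor s [s c (fun1 f x)]" for c x
    by (simp add: fun1[OF f, symmetric] tscale_pure_Cons[symmetric] tlinear_scale[OF f pure_in])
  ultimately show ?thesis by (simp add: lin_def)
qed

lemma bilin_fun2:
  assumes f: "f \<in> tlinear s 2 1" shows "bilin s s (fun2 f)"
proof -
  have p: "pure_tensor s [x, y] \<in> tensor_power s 2" for x y by simp
  have "pure_tensor s [fun2 f (x + x') y] = pure_tensor s [fun2 f x y + fun2 f x' y]" for x x' y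
    using pure_add[of "[]" x x' "[y]"]
    by (simp add: fun2[OF f, symmetric] tadd_pure_1[symmetric] tlinear_add[OF f p p])
  moreover have "pure_tensor s [fun2 f x (y + y')] = pure_tensor s [fun2 f x y + fun2 f x y']" for x y y'
    using pure_add[of "[x]" y y' "[]"]
    by (simp add: fun2[OF f, symmetric] tadd_pure_1[symmetric] tlinear_add[OF f p p])
  moreover have "pure_tensor s [fun2 f (s c x) y] = pure_tensor s [s c (fun2 f x y)]" for c x y
    using pure_scale[of "[]" c x "[y]"]
    by (simp add: fun2[OF f, symmetric] tscale_pure_Cons[of _ _ "[]", symmetric] tlinear_scale[OF f p])
  moreover have "pure_tensor s [fun2 f x (s c y)] = pure_tensor s [s c (fun2 f x y)]" for c x y
    using pure_scale[of "[x]" c y "[]"]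
    by (simp add: fun2[OF f, symmetric] tscale_pure_Cons[of _ _ "[]", symmetric] tlinear_scale[OF f p])
  ultimately show ?thesis by (simp add: lin_def bilin_def)
qed

lemma lsum_cop_eq_teval:
  assumes "\<Delta> \<in> tlinear s 1 2" "module sW" "bilin s sW F"
  shows "lsum (cop \<Delta> x) F = teval sW 2 (\<lambda>xs. F (xs ! 0) (xs ! 1)) (\<Delta> (pure_tensor s [x]))"
  by (simp add: cop[OF assms(1)] teval_tlsum[OF assms(2) mlin_2[OF assms(3)], where m = 2]
      teval_pure[OF assms(2) mlin_2[OF assms(3)]] del: One_nat_def)

text \<open>The sum is the evaluation of \<open>F\<close> at the tensor \<Delta>(x), in which the
  arbitrary choice of the list has disappeared.\<close>

lemma lin_lsum_cop:
  assumes D: "\<Delta> \<in> tlinear s 1 2" and W: "module sW" and F: "bilin s sW F"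
  shows "lin s sW (\<lambda>x. lsum (cop \<Delta> x) F)"
proof -
  have p: "pure_tensor s [x] \<in> tensor_power s 1" for x by simp
  show ?thesis
    unfolding lin_def lsum_cop_eq_teval[OF assms] tadd_pure_1[symmetric]
      tscale_pure_Cons[of _ _ "[]", symmetric] tlinear_add[OF D p p] tlinear_scale[OF D p]
    by (intro conjI allI teval_tadd[OF W mlin_2[OF F] tlinear_in[OF D p] tlinear_in[OF D p]]
        teval_tscale[OF W mlin_2[OF F] tlinear_in[OF D p]])
qed

lemma range_tscale [simp]: "X \<in> range (tcls s) \<Longrightarrow> tscale s c X \<in> range (tcls s)"
  by auto

text \<open>Rewrite rules that turn a composite of \<open>tmap\<close>s applied to a pure tensor
  into nested sums of pure tensors; each axiom thereby becomes its Sweedler form.\<close>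

lemmas tensor_eval =
  tmap_tlinear id_tlinear tflip_tlinear tmap_pure tmap_tlsum tflip_pure tmult_tlsum_left tmult_tlsum_right
  tscale_pure_Cons tmult_tscale_left tmult_tscale_right take_Cons' drop_Cons' tadd_pure_1 tlsum_pure_1

lemma teval_pure_2:
  assumes "module sW" "bilin s sW F"
  shows "teval sW 2 (\<lambda>xs. F (xs ! 0) (xs ! 1)) (pure_tensor s [x, y]) = F x y"
  by (subst teval_pure[OF assms(1) mlin_2[OF assms(2)]]) simp_all

text \<open>The constant 1 is vacuously multilinear in zero arguments; evaluating it identifies the
  power of degree 0 with the ring of scalars.\<close>

lemma teval_tscale_pure_Nil: "teval (*) 0 (\<lambda>_. 1) (tscale s c (pure_tensor s [])) = c"
proof -
  have M: "module ((*) :: 'r \<Rightarrow> 'r \<Rightarrow> 'r)" by unfold_locales (auto simp: algebra_simps)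
  have 0: "mlin s (*) 0 (\<lambda>_. 1 :: 'r)" by (simp add: mlin_iff)
  show ?thesis
    using teval_tscale[OF M 0 pure_in, of "[]" 0 c] teval_pure[OF M 0, of "[]"] by simp
qed

lemma tscale_pure_Nil_inject: "tscale s c (pure_tensor s []) = tscale s d (pure_tensor s []) \<longleftrightarrow> c = d"
  by (metis teval_tscale_pure_Nil)

lemma teval_pure_3:
  assumes "module sW" "trilin s sW F"
  shows "teval sW 3 (\<lambda>xs. F (xs ! 0) (xs ! 1) (xs ! 2)) (pure_tensor s [x, y, z]) = F x y z"
  by (subst teval_pure[OF assms(1) mlin_3[OF assms(2)]]) simp_all

end

section \<open>Hopf algebra identities in Sweedler notation\<close>

sublocale hopf_algebra \<subseteq> tensor_module scale
  by unfold_locales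

context hopf_algebra
begin

abbreviation mul (infixl "\<star>" 70) where "x \<star> y \<equiv> fun2 \<mu> x y"
abbreviation sw where "sw y F \<equiv> lsum (cop \<Delta> y) F"
abbreviation anti where "anti \<equiv> fun1 S"
abbreviation ad where "ad x y \<equiv> sw y (\<lambda>a b. anti a \<star> (x \<star> b))"
definition one where "one = teval scale 1 hd (\<eta> (pure_tensor scale []))"
definition cu where "cu x = teval (*) 0 (\<lambda>_. 1) (\<epsilon> (pure_tensor scale [x]))"

lemma unit_pure: "\<eta> (pure_tensor scale []) = pure_tensor scale [one]"
proof -
  have "\<eta> (pure_tensor scale []) \<in> tensor_power scale 1" by (rule tlinear_in[OF unit_linear]) simp
  then show ?thesis unfolding one_def by (elim tpower_1E) (simp del: One_nat_def)
qed

lemma counit_pure: "\<epsilon> (pure_tensor scale [x]) = tscale scale (cu x) (pure_tensor scale [])"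
proof -
  have "\<epsilon> (pure_tensor scale [x]) \<in> tensor_power scale 0" by (rule tlinear_in[OF counit_linear]) simp
  then obtain c where c: "\<epsilon> (pure_tensor scale [x]) = tscale scale c (pure_tensor scale [])" by (rule tpower_0E)
  have "cu x = c"
    unfolding cu_def c by (simp add: teval_tscale_pure_Nil)
  with c show ?thesis by simp
qed

lemmas structure_linear = mult_linear unit_linear comult_linear counit_linear antipode_linear

lemmas structure_eval = tensor_eval structure_linear fun2[OF mult_linear] cop[OF comult_linear] fun1[OF antipode_linear]
  unit_pure counit_pure tlinear_tlsum[OF mult_linear] tlinear_tlsum[OF comult_linear] tlinear_tlsum[OF antipode_linear]

lemma mul_assoc: "x \<star> y \<star> z = x \<star> (y \<star> z)"
  using mult_assoc[of "pure_tensor scale [x, y, z]"] by (simp add: structure_eval del: One_nat_def)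

lemma one_mul [simp]: "one \<star> x = x" and mul_one [simp]: "x \<star> one = x"
  using unit_left[of "pure_tensor scale [x]"] unit_right[of "pure_tensor scale [x]"]
  by (simp_all add: structure_eval del: One_nat_def)

lemma coassoc_tensor: "tlsum scale (cop \<Delta> y) (\<lambda>a b. tlsum scale (cop \<Delta> a) (\<lambda>c d. pure_tensor scale [c, d, b])) =
    tlsum scale (cop \<Delta> y) (\<lambda>a b. tlsum scale (cop \<Delta> b) (\<lambda>c d. pure_tensor scale [a, c, d]))"
  using comult_coassoc[of "pure_tensor scale [y]"] by (simp add: structure_eval del: One_nat_def)

text \<open>The target module is left arbitrary so that \<open>F\<close> may contain further
  Sweedler sums and may later take values in k[[t]]/(t^2).\<close>

lemma sw_coassoc:
  assumes "module sW" "trilin scale sW F"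
  shows "sw y (\<lambda>a b. sw a (\<lambda>c d. F c d b)) = sw y (\<lambda>a b. sw b (\<lambda>c d. F a c d))"
  using arg_cong[OF coassoc_tensor, of "teval sW 3 (\<lambda>xs. F (xs ! 0) (xs ! 1) (xs ! 2))"]
  by (simp add: teval_tlsum[OF assms(1) mlin_3[OF assms(2)], where m = 3] teval_pure_3[OF assms] del: One_nat_def)

lemma sw_counit_left: "sw y (\<lambda>a b. scale (cu a) b) = y"
  and sw_counit_right: "sw y (\<lambda>a b. scale (cu b) a) = y"
  using counit_left[of "pure_tensor scale [y]"] counit_right[of "pure_tensor scale [y]"]
  by (simp_all add: structure_eval del: One_nat_def)

lemma sw_antipode_left: "sw y (\<lambda>a b. anti a \<star> b) = scale (cu y) one"
  and sw_antipode_right: "sw y (\<lambda>a b. a \<star> anti b) = scale (cu y) one"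
  using antipode_left[of "pure_tensor scale [y]"] antipode_right[of "pure_tensor scale [y]"]
  by (simp_all add: structure_eval tlinear_scale[OF unit_linear] del: One_nat_def)

lemma cu_mul: "cu (x \<star> y) = cu x * cu y"
proof -
  have "tscale scale (cu (x \<star> y)) (pure_tensor scale []) = tscale scale (cu y) (tscale scale (cu x) (pure_tensor scale []))"
    using counit_mult[of "pure_tensor scale [x, y]"] by (simp add: structure_eval del: One_nat_def)
  also have "\<dots> = tscale scale (cu x * cu y) (pure_tensor scale [])"
    by (simp add: pure_tensor_def mult.commute)
  finally show ?thesis by (simp add: tscale_pure_Nil_inject)
qed

lemma sw_mul:
  assumes "module sW" "bilin scale sW F"
  shows "sw (x \<star> y) F = sw x (\<lambda>a b. sw y (\<lambda>c d. F (a \<star> c) (b \<star> d)))"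
proof -
  have "tlsum scale (cop \<Delta> (x \<star> y)) (\<lambda>a b. pure_tensor scale [a, b]) =
     tlsum scale (cop \<Delta> y) (\<lambda>c d. tlsum scale (cop \<Delta> x) (\<lambda>a b. pure_tensor scale [a \<star> c, b \<star> d]))"
    using comult_mult[of "pure_tensor scale [x, y]"] by (simp add: structure_eval del: One_nat_def)
  from arg_cong[OF this, of "teval sW 2 (\<lambda>xs. F (xs ! 0) (xs ! 1))"] show ?thesis
    by (subst lsum_swap) (simp add: teval_tlsum[OF assms(1) mlin_2[OF assms(2)], where m = 2] teval_pure_2[OF assms] del: One_nat_def)
qed

lemma sw_one:
  assumes "module sW" "bilin scale sW F"
  shows "sw one F = F one one"
proof -
  have "tlsum scale (cop \<Delta> one) (\<lambda>a b. pure_tensor scale [a, b]) = pure_tensor scale [one, one]"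
    using comult_unit[of "pure_tensor scale []"] by (simp add: structure_eval del: One_nat_def)
  from arg_cong[OF this, of "teval sW 2 (\<lambda>xs. F (xs ! 0) (xs ! 1))"] show ?thesis
    by (simp add: teval_tlsum[OF assms(1) mlin_2[OF assms(2)], where m = 2] teval_pure_2[OF assms] del: One_nat_def)
qed

lemma adjoint_pure: "adjoint_map scale \<mu> \<Delta> S (pure_tensor scale [x, y]) = pure_tensor scale [ad x y]"
  by (simp add: adjoint_map_def structure_eval del: One_nat_def)

lemma adjoint_linear: "adjoint_map scale \<mu> \<Delta> S \<in> tlinear scale 2 1"
proof -
  note l = tmap_tlinear tflip_tlinear id_tlinear structure_linear
  have 1: "tmap scale (1, 1) id (1, 2) \<Delta> \<in> tlinear scale 2 3"
    and 2: "tmap scale (2, 2) (tflip scale) (1, 1) id \<in> tlinear scale 3 3"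
    and 3: "tmap scale (1, 1) S (2, 2) id \<in> tlinear scale 3 3"
    and 4: "tmap scale (1, 1) id (2, 1) \<mu> \<in> tlinear scale 3 2"
    by (simp_all add: l del: One_nat_def)
  show ?thesis
    unfolding adjoint_map_def[abs_def]
    by (intro tlinear_comp[OF _ mult_linear] tlinear_comp[OF _ 4] tlinear_comp[OF _ 3] tlinear_comp[OF _ 2] 1)
qed

lemma fun2_adjoint: "fun2 (adjoint_map scale \<mu> \<Delta> S) x y = ad x y"
  by (rule fun2_eqI) (rule adjoint_pure)

lemmas mul_bilin = bilin_fun2[OF mult_linear]
lemmas ad_bilin = bilin_fun2[OF adjoint_linear, unfolded fun2_adjoint]

lemmas mul_simps = mul_bilin[unfolded bilin_def lin_def, THEN conjunct1, rule_format, THEN conjunct1, rule_format]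
  mul_bilin[unfolded bilin_def lin_def, THEN conjunct1, rule_format, THEN conjunct2, rule_format]
  mul_bilin[unfolded bilin_def lin_def, THEN conjunct2, rule_format, THEN conjunct1, rule_format]
  mul_bilin[unfolded bilin_def lin_def, THEN conjunct2, rule_format, THEN conjunct2, rule_format]

lemmas anti_simps = lin_fun1[OF antipode_linear, unfolded lin_def, THEN conjunct1, rule_format]
  lin_fun1[OF antipode_linear, unfolded lin_def, THEN conjunct2, rule_format]

lemma lin_sw: "module sW \<Longrightarrow> bilin scale sW F \<Longrightarrow> lin scale sW (\<lambda>y. sw y F)"
  by (rule lin_lsum_cop[OF comult_linear])

lemma sw_simps:
  assumes "module sW" "bilin scale sW F"
  shows "sw (x + y) F = sw x F + sw y F" "sw (scale c x) F = sW c (sw x F)"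
  using lin_sw[OF assms] by (simp_all add: lin_def)

lemma lin_lsum: "lin scale sW f \<Longrightarrow> f (lsum l F) = lsum l (\<lambda>a b. f (F a b))"
  by (rule lsum_additive) (simp add: lin_def)

text \<open>With the counit as a scalar on the target of a linear \<open>f\<close>, the counit law
  can be applied anywhere inside a nested Sweedler sum. The next three lemmas serve the same purpose
  for the other axioms.\<close>

lemma sw_counit_left_lin: "lin scale sW f \<Longrightarrow> sw y (\<lambda>a b. sW (cu a) (f b)) = f y"
  using lin_lsum[of sW f "cop \<Delta> y" "\<lambda>a b. scale (cu a) b"] by (simp add: sw_counit_left lin_def)

lemma sw_counit_right_lin: "lin scale sW f \<Longrightarrow> sw y (\<lambda>a b. sW (cu b) (f a)) = f y"
  using lin_lsum[of sW f "cop \<Delta> y" "\<lambda>a b. scale (cu b) a"] by (simp add: sw_counit_right lin_def)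

lemma sw_antipode_left_lin: "lin scale sW f \<Longrightarrow> sw y (\<lambda>a b. f (anti a \<star> b)) = sW (cu y) (f one)"
  using lin_lsum[of sW f "cop \<Delta> y" "\<lambda>a b. anti a \<star> b"] by (simp add: sw_antipode_left lin_def)

lemma sw_antipode_right_lin: "lin scale sW f \<Longrightarrow> sw y (\<lambda>a b. f (a \<star> anti b)) = sW (cu y) (f one)"
  using lin_lsum[of sW f "cop \<Delta> y" "\<lambda>a b. a \<star> anti b"] by (simp add: sw_antipode_right lin_def)

lemmas lin_defs = lin_def bilin_def trilin_def

text \<open>In the convolution algebra of bilinear maps from \<open>H \<times> H\<close> to \<open>H\<close>, both sides are inverse to \<open>\<star>\<close>.\<close>

lemma anti_mul: "anti (x \<star> y) = anti y \<star> anti x"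
proof -
  note sc = module_axioms
  note simps = lin_defs mul_simps anti_simps lsum_add lsum_scale scale_right_distrib
  have "anti (x \<star> y) = sw x (\<lambda>x1 x'. scale (cu x') (anti (x1 \<star> y)))"
    by (rule sw_counit_right_lin[symmetric]) (simp add: simps)
  also have "\<dots> = sw x (\<lambda>x1 x'. scale (cu x') (sw y (\<lambda>y1 y'. scale (cu y') (anti (x1 \<star> y1)))))"
    by (subst sw_counit_right_lin) (simp_all add: simps)
  \<comment> \<open>The counits of the outer components of \<open>x\<close> and \<open>y\<close> are
    expanded, here and in the next step, so that S(x1 y1) is multiplied on the right by x2 (y2
    S(y3)) S(x3).\<close>
  also have "\<dots> = sw x (\<lambda>x1 x'. sw y (\<lambda>y1 y'. sw x' (\<lambda>x2 x3. scale (cu y') (anti (x1 \<star> y1) \<star> (x2 \<star> anti x3)))))"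
    by (subst sw_antipode_right_lin[of scale]) (simp_all add: lin_defs mul_simps scale_right_distrib mult.commute flip: lsum_scale)
  also have "\<dots> = sw x (\<lambda>x1 x'. sw y (\<lambda>y1 y'. sw x' (\<lambda>x2 x3. sw y' (\<lambda>y2 y3. anti (x1 \<star> y1) \<star> (x2 \<star> ((y2 \<star> anti y3) \<star> anti x3))))))"
    by (subst sw_antipode_right_lin[of scale]) (simp_all add: simps)
  also have "\<dots> = sw x (\<lambda>x1 x'. sw x' (\<lambda>x2 x3. sw y (\<lambda>y1 y'. sw y' (\<lambda>y2 y3. anti (x1 \<star> y1) \<star> (x2 \<star> ((y2 \<star> anti y3) \<star> anti x3))))))"
    by (subst lsum_swap) simp
  also have "\<dots> = sw x (\<lambda>x' x3. sw x' (\<lambda>x1 x2. sw y (\<lambda>y1 y'. sw y' (\<lambda>y2 y3. anti (x1 \<star> y1) \<star> (x2 \<star> ((y2 \<star> anti y3) \<star> anti x3))))))"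
    by (subst sw_coassoc[OF sc]) (simp_all add: simps)
  also have "\<dots> = sw x (\<lambda>x' x3. sw x' (\<lambda>x1 x2. sw y (\<lambda>y' y3. sw y' (\<lambda>y1 y2. anti (x1 \<star> y1) \<star> (x2 \<star> ((y2 \<star> anti y3) \<star> anti x3))))))"
    by (subst sw_coassoc[OF sc, of "\<lambda>y1 y2 y3. anti (_ \<star> y1) \<star> (_ \<star> ((y2 \<star> anti y3) \<star> anti _))"]) (simp_all add: simps)
  also have "\<dots> = sw x (\<lambda>x' x3. sw y (\<lambda>y' y3. sw x' (\<lambda>x1 x2. sw y' (\<lambda>y1 y2. (anti (x1 \<star> y1) \<star> (x2 \<star> y2)) \<star> (anti y3 \<star> anti x3)))))"
    by (subst lsum_swap) (simp add: mul_assoc)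
  \<comment> \<open>Multiplicativity of \<Delta> recognises S(x1 y1) x2 y2 as the antipode
    expression for the single element x' y', which collapses to a counit.\<close>
  also have "\<dots> = sw x (\<lambda>x' x3. sw y (\<lambda>y' y3. sw (x' \<star> y') (\<lambda>u v. (anti u \<star> v) \<star> (anti y3 \<star> anti x3))))"
    by (subst sw_mul[OF sc]) (simp_all add: simps)
  also have "\<dots> = sw x (\<lambda>x' x3. sw y (\<lambda>y' y3. scale (cu (x' \<star> y')) (anti y3 \<star> anti x3)))"
    by (subst sw_antipode_left_lin[of scale]) (simp_all add: simps)
  also have "\<dots> = sw x (\<lambda>x' x3. scale (cu x') (sw y (\<lambda>y' y3. scale (cu y') (anti y3 \<star> anti x3))))"
    by (simp add: cu_mul flip: lsum_scale)
  also have "\<dots> = sw x (\<lambda>x' x3. scale (cu x') (anti y \<star> anti x3))"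
    by (subst sw_counit_left_lin) (simp_all add: simps)
  also have "\<dots> = anti y \<star> anti x"
    by (subst sw_counit_left_lin) (simp_all add: simps)
  finally show ?thesis .
qed

text \<open>\<open>\<Delta> \<circ> S\<close> and \<open>(S \<otimes> S) \<circ> \<tau> \<circ> \<Delta>\<close> are both convolution inverses of \<open>\<Delta>\<close>; identities between
  tensors are stated by applying an arbitrary bilinear map \<open>F\<close>.\<close>

lemma sw_anti_aux:
  assumes W: "module sW" and F: "bilin scale sW F"
  shows "sw b (\<lambda>u v. sw u (\<lambda>u1 u2. sw v (\<lambda>v1 v2. F (u1 \<star> anti v2) (u2 \<star> anti v1)))) = sW (cu b) (F one one)"
proof -
  interpret W: module sW by (rule W)
  note simps = lin_defs mul_simps anti_simps lsum_add W.lsum_scale W.scale_right_distrib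
    F[unfolded lin_defs, rule_format] sw_simps[OF W]
  have "sw b (\<lambda>u v. sw u (\<lambda>u1 u2. sw v (\<lambda>v1 v2. F (u1 \<star> anti v2) (u2 \<star> anti v1))))
      = sw b (\<lambda>u v. sw v (\<lambda>w v. sw v (\<lambda>v1 v2. F (u \<star> anti v2) (w \<star> anti v1))))"
    by (subst sw_coassoc[OF W]) (simp_all add: simps)
  also have "\<dots> = sw b (\<lambda>u v. sw v (\<lambda>v' v2. sw v' (\<lambda>w v1. F (u \<star> anti v2) (w \<star> anti v1))))"
    by (subst sw_coassoc[OF W, of "\<lambda>w v1 v2. F (_ \<star> anti v2) (w \<star> anti v1)"]) (simp_all add: simps)
  \<comment> \<open>In b1 S(b4) \<otimes> b2 S(b3) the inner pair b2, b3 is adjacent and cancels;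
    after the counit law the outer pair becomes adjacent as well.\<close>
  also have "\<dots> = sw b (\<lambda>u v. sw v (\<lambda>v' v2. sW (cu v') (F (u \<star> anti v2) one)))"
    by (subst sw_antipode_right_lin[of sW]) (simp_all add: simps)
  also have "\<dots> = sw b (\<lambda>u v. F (u \<star> anti v) one)"
    by (subst sw_counit_left_lin[of sW]) (simp_all add: simps)
  also have "\<dots> = sW (cu b) (F one one)"
    by (subst sw_antipode_right_lin[of sW]) (simp_all add: simps)
  finally show ?thesis .
qed

lemma sw_anti:
  assumes W: "module sW" and F: "bilin scale sW F"
  shows "sw (anti y) F = sw y (\<lambda>a b. F (anti b) (anti a))"
proof -
  interpret W: module sW by (rule W)
  note simps = lin_defs mul_simps anti_simps lsum_add W.lsum_scale W.scale_right_distrib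
    F[unfolded lin_defs, rule_format] sw_simps[OF W]
  have "sw (anti y) F = sw y (\<lambda>a b. sW (cu b) (sw (anti a) F))"
    by (rule sw_counit_right_lin[symmetric]) (simp add: simps)
  also have "\<dots> = sw y (\<lambda>a b. sw (anti a) (\<lambda>p q. sW (cu b) (F p q)))"
    by (simp add: W.lsum_scale)
  \<comment> \<open>The preceding lemma, applied to the bilinear map (u, v) \<mapsto> F(p u, q v),
    inserts \<Delta>(u) times the reversed antipodes of v to the right of \<Delta>(S(a)). Then
    \<Delta>(S(a)) \<Delta>(u) = \<Delta>(S(a) u) collapses by the antipode axiom.\<close>
  also have "\<dots> = sw y (\<lambda>a b. sw (anti a) (\<lambda>p q. sw b (\<lambda>u v. sw u (\<lambda>u1 u2. sw v (\<lambda>v1 v2.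
      F (p \<star> (u1 \<star> anti v2)) (q \<star> (u2 \<star> anti v1)))))))"
    by (subst sw_anti_aux[OF W]) (simp_all add: simps)
  also have "\<dots> = sw y (\<lambda>a b. sw b (\<lambda>u v. sw (anti a) (\<lambda>p q. sw u (\<lambda>u1 u2. sw v (\<lambda>v1 v2.
      F (p \<star> u1 \<star> anti v2) (q \<star> u2 \<star> anti v1))))))"
    by (subst lsum_swap) (simp add: mul_assoc)
  also have "\<dots> = sw y (\<lambda>a b. sw b (\<lambda>u v. sw (anti a \<star> u) (\<lambda>p q. sw v (\<lambda>v1 v2. F (p \<star> anti v2) (q \<star> anti v1)))))"
    by (subst sw_mul[OF W]) (simp_all add: simps)
  also have "\<dots> = sw y (\<lambda>b v. sw b (\<lambda>a u. sw (anti a \<star> u) (\<lambda>p q. sw v (\<lambda>v1 v2. F (p \<star> anti v2) (q \<star> anti v1)))))"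
    by (subst sw_coassoc[OF W]) (simp_all add: simps)
  also have "\<dots> = sw y (\<lambda>b v. sW (cu b) (sw one (\<lambda>p q. sw v (\<lambda>v1 v2. F (p \<star> anti v2) (q \<star> anti v1)))))"
    by (subst sw_antipode_left_lin[of sW]) (simp_all add: simps)
  also have "\<dots> = sw y (\<lambda>b v. sW (cu b) (sw v (\<lambda>v1 v2. F (anti v2) (anti v1))))"
    by (subst sw_one[OF W]) (simp_all add: simps)
  also have "\<dots> = sw y (\<lambda>a b. F (anti b) (anti a))"
    by (subst sw_counit_left_lin) (simp_all add: simps)
  finally show ?thesis .
qed

section \<open>Conditions (1) and (2) for the adjoint map\<close>

lemma ad_ad: "ad (ad x y) z = ad x (y \<star> z)"
proof -
  note simps = lin_defs mul_simps anti_simps lsum_add lsum_scale scale_right_distrib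
  have "ad x (y \<star> z) = sw y (\<lambda>a b. sw z (\<lambda>c d. anti (a \<star> c) \<star> (x \<star> (b \<star> d))))"
    by (rule sw_mul[OF module_axioms]) (simp add: simps)
  \<comment> \<open>S(a c) = S(c) S(a) turns the expression for the product y z into that for y
    nested in that for z.\<close>
  also have "\<dots> = sw y (\<lambda>a b. sw z (\<lambda>c d. anti c \<star> ((anti a \<star> (x \<star> b)) \<star> d)))"
    by (simp add: anti_mul mul_assoc)
  also have "\<dots> = sw z (\<lambda>c d. sw y (\<lambda>a b. anti c \<star> ((anti a \<star> (x \<star> b)) \<star> d)))"
    by (rule lsum_swap)
  also have "\<dots> = ad (ad x y) z"
    by (subst lin_lsum[of scale "\<lambda>u. anti _ \<star> (u \<star> _)"]) (simp_all add: simps)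
  finally show ?thesis ..
qed

text \<open>On the right, \<Delta>(S(y2) x y3) has the later half of the reversed S in its first leg
  and the earlier half in its second. There it stands directly after the extra factor y1, so y1
  S(y2) cancels and the left side remains.\<close>

lemma sw_ad:
  assumes W: "module sW" and F: "bilin scale sW F"
  shows "sw x (\<lambda>x1 x2. sw y (\<lambda>y1 y2. F (ad x1 y1) (x2 \<star> y2))) = sw y (\<lambda>y1 y2. sw (ad x y2) (\<lambda>p q. F p (y1 \<star> q)))"
proof -
  interpret W: module sW by (rule W)
  note simps = lin_defs mul_simps anti_simps lsum_add W.lsum_scale W.scale_right_distrib
    F[unfolded lin_defs, rule_format] sw_simps[OF W]
  have lin_F: "F (lsum l f) q = lsum l (\<lambda>a b. F (f a b) q)" for l :: "('h \<times> 'h) list" and f q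
    by (rule lin_lsum[of sW "\<lambda>p. F p q"]) (simp add: simps)
  have "sw y (\<lambda>y1 y2. sw (ad x y2) (\<lambda>p q. F p (y1 \<star> q)))
      = sw y (\<lambda>y1 y2. sw y2 (\<lambda>a b. sw (anti a \<star> (x \<star> b)) (\<lambda>p q. F p (y1 \<star> q))))"
    by (subst lin_lsum[of sW "\<lambda>z. sw z _"]) (simp_all add: simps)
  also have "\<dots> = sw y (\<lambda>y1 y2. sw y2 (\<lambda>a b. sw (anti a) (\<lambda>p q. sw x (\<lambda>x1 x2. sw b (\<lambda>b1 b2.
      F (p \<star> (x1 \<star> b1)) (y1 \<star> (q \<star> (x2 \<star> b2))))))))"
    by (subst sw_mul[OF W], simp add: simps, subst sw_mul[OF W]) (simp_all add: simps)
  also have "\<dots> = sw y (\<lambda>y1 y2. sw y2 (\<lambda>a b. sw a (\<lambda>a1 a2. sw x (\<lambda>x1 x2. sw b (\<lambda>b1 b2.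
      F (anti a2 \<star> (x1 \<star> b1)) (y1 \<star> (anti a1 \<star> (x2 \<star> b2))))))))"
    by (subst sw_anti[OF W]) (simp_all add: simps)
  also have "\<dots> = sw y (\<lambda>c b. sw c (\<lambda>y1 a. sw a (\<lambda>a1 a2. sw x (\<lambda>x1 x2. sw b (\<lambda>b1 b2.
      F (anti a2 \<star> (x1 \<star> b1)) (y1 \<star> (anti a1 \<star> (x2 \<star> b2))))))))"
    by (subst sw_coassoc[OF W]) (simp_all add: simps)
  \<comment> \<open>Coassociativity makes \<open>y1\<close> and \<open>a1\<close> the two components
    of one element \<open>d\<close>, the form in which the antipode axiom applies.\<close>
  also have "\<dots> = sw y (\<lambda>c b. sw c (\<lambda>d a2. sw d (\<lambda>y1 a1. sw x (\<lambda>x1 x2. sw b (\<lambda>b1 b2.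
      F (anti a2 \<star> (x1 \<star> b1)) ((y1 \<star> anti a1) \<star> (x2 \<star> b2)))))))"
    by (subst sw_coassoc[OF W, of "\<lambda>y1 a1 a2. sw x (\<lambda>x1 x2. sw _ (\<lambda>b1 b2.
      F (anti a2 \<star> (x1 \<star> b1)) ((y1 \<star> anti a1) \<star> (x2 \<star> b2))))"]) (simp_all add: simps mul_assoc)
  also have "\<dots> = sw y (\<lambda>c b. sw c (\<lambda>d a2. sW (cu d) (sw x (\<lambda>x1 x2. sw b (\<lambda>b1 b2.
      F (anti a2 \<star> (x1 \<star> b1)) (x2 \<star> b2))))))"
    by (subst sw_antipode_right_lin[of sW]) (simp_all add: simps)
  also have "\<dots> = sw y (\<lambda>c b. sw x (\<lambda>x1 x2. sw b (\<lambda>b1 b2. F (anti c \<star> (x1 \<star> b1)) (x2 \<star> b2))))"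
    by (subst sw_counit_left_lin[of sW]) (simp_all add: simps)
  also have "\<dots> = sw x (\<lambda>x1 x2. sw y (\<lambda>c b. sw b (\<lambda>b1 b2. F (anti c \<star> (x1 \<star> b1)) (x2 \<star> b2))))"
    by (rule lsum_swap)
  also have "\<dots> = sw x (\<lambda>x1 x2. sw y (\<lambda>y1 y2. sw y1 (\<lambda>a b. F (anti a \<star> (x1 \<star> b)) (x2 \<star> y2))))"
    by (subst sw_coassoc[OF W, of "\<lambda>a b y2. F (anti a \<star> (_ \<star> b)) (_ \<star> y2)"]) (simp_all add: simps)
  also have "\<dots> = sw x (\<lambda>x1 x2. sw y (\<lambda>y1 y2. F (ad x1 y1) (x2 \<star> y2)))"
    by (simp add: lin_F)
  finally show ?thesis ..
qed

section \<open>The cocycle conditions in Sweedler notation\<close>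

context
  fixes \<phi>
  assumes \<phi>: "\<phi> \<in> adjoint_2_cocycles scale \<mu> \<Delta> S"
begin

lemma cocycle_linear: "\<phi> \<in> tlinear scale 2 1"
  using \<phi> by (simp add: adjoint_2_cocycles_def)

lemmas cocycle_eval = structure_eval cocycle_linear fun2[OF cocycle_linear] tlinear_tlsum[OF cocycle_linear]
  adjoint_linear adjoint_pure

text \<open>One side of (1) composes q with itself, so its coefficient of t has two mixed
  terms.\<close>

lemma cocycle_ad: "ad (fun2 \<phi> x y) z + fun2 \<phi> (ad x y) z = fun2 \<phi> x (y \<star> z)"
proof -
  have "tdiff scale
          (tadd scale (adjoint_map scale \<mu> \<Delta> S (tmap scale (2, 1) \<phi> (1, 1) id (pure_tensor scale [x, y, z])))
                  (\<phi> (tmap scale (2, 1) (adjoint_map scale \<mu> \<Delta> S) (1, 1) id (pure_tensor scale [x, y, z]))))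
          (\<phi> (tmap scale (1, 1) id (2, 1) \<mu> (pure_tensor scale [x, y, z]))) = tzero scale"
    using \<phi> by (simp add: adjoint_2_cocycles_def)
  then show ?thesis
    by (simp add: cocycle_eval tdiff_eq_tzero_iff[where n = 1] del: One_nat_def)
qed

text \<open>Condition (2) is linear in q, so its coefficient of t has exactly the shape of
  \<open>sw_ad\<close> with \<open>\<phi>\<close> in place of ad; both are later applied to the same
  \<open>F\<close>.\<close>

lemma sw_cocycle:
  assumes W: "module sW" and F: "bilin scale sW F"
  shows "sw x (\<lambda>x1 x2. sw y (\<lambda>y1 y2. F (fun2 \<phi> x1 y1) (x2 \<star> y2)))
    = sw y (\<lambda>y1 y2. sw (fun2 \<phi> x y2) (\<lambda>p q. F p (y1 \<star> q)))"
proof -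
  have "tdiff scale
          (tmap scale (2, 1) \<phi> (2, 1) \<mu>
            (tmap scale (1, 1) id (3, 3) (tmap scale (2, 2) (tflip scale) (1, 1) id)
              (tmap scale (1, 2) \<Delta> (1, 2) \<Delta> (pure_tensor scale [x, y]))))
          (tmap scale (1, 1) id (2, 1) \<mu>
            (tmap scale (2, 2) (tflip scale) (1, 1) id
              (tmap scale (1, 1) id (1, 2) \<Delta>
                (tmap scale (1, 1) id (2, 1) \<phi>
                  (tmap scale (2, 2) (tflip scale) (1, 1) id
                    (tmap scale (1, 1) id (1, 2) \<Delta> (pure_tensor scale [x, y]))))))) = tzero scale"
    using \<phi> by (simp add: adjoint_2_cocycles_def)
  then have "tlsum scale (cop \<Delta> y) (\<lambda>y1 y2. tlsum scale (cop \<Delta> x) (\<lambda>x1 x2. pure_tensor scale [fun2 \<phi> x1 y1, x2 \<star> y2])) =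
     tlsum scale (cop \<Delta> y) (\<lambda>y1 y2. tlsum scale (cop \<Delta> (fun2 \<phi> x y2)) (\<lambda>p q. pure_tensor scale [p, y1 \<star> q]))"
    by (simp add: cocycle_eval tdiff_eq_tzero_iff[where n = 2] del: One_nat_def)
  from arg_cong[OF this, of "teval sW 2 (\<lambda>xs. F (xs ! 0) (xs ! 1))"] show ?thesis
    by (subst lsum_swap) (simp add: teval_tlsum[OF W mlin_2[OF F], where m = 2] teval_pure_2[OF assms] del: One_nat_def)
qed

end

end

section \<open>Extension of scalars\<close>

lemma trunc_eq_iff: "c = d \<longleftrightarrow> trunc_coeff0 c = trunc_coeff0 d \<and> trunc_coeff1 c = trunc_coeff1 d"
  by (metis trunc_decomp)

lemma trunc_const_simps [simp]:
  "trunc_const (a + b) = trunc_const a + trunc_const b"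
  "trunc_const (a * b) = trunc_const a * trunc_const b"
  "trunc_const 0 = 0" "trunc_const 1 = 1"
  by (simp_all add: trunc_eq_iff)

lemma trunc_t_t [simp]: "trunc_t * trunc_t = 0" "trunc_t * (trunc_t * c) = 0"
  by (simp_all add: trunc_eq_iff)

definition emb :: "'h::ab_group_add \<Rightarrow> 'h \<times> 'h" where
  "emb x = (x, 0)"

lemma emb_add: "emb (x + y) = emb x + emb y"
  by (simp add: emb_def)

locale trunc_extension = vector_space scale for scale :: "'k::field \<Rightarrow> 'h::ab_group_add \<Rightarrow> 'h"
begin

abbreviation As where "As \<equiv> trunc_scale scale"

sublocale H: tensor_module scale
  by unfold_locales

sublocale A: tensor_module As
  unfolding tensor_module_def by (rule module_trunc_scale) unfold_locales

lemma emb_scale: "emb (scale c x) = As (trunc_const c) (emb x)"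
  by (simp add: emb_def trunc_scale_def)

lemma emb_decomp: "z = emb (fst z) + As trunc_t (emb (snd z))"
  by (simp add: emb_def trunc_scale_def prod_eq_iff)

text \<open>Restriction of scalars: the free module over k[[t]]/(t^2) regarded as a vector space
  over \<open>k\<close>.\<close>

abbreviation fs where "fs \<equiv> (\<lambda>c. fscale (trunc_const c)) :: 'k \<Rightarrow> ('x \<Rightarrow>\<^sub>0 'k trunc) \<Rightarrow> _"

lemma fs_module: "vector_space fs"
  by unfold_locales (simp_all add: free.scale_right_distrib free.scale_left_distrib)

text \<open>\<open>emb\<close> sends relations over \<open>H\<close> to relations over
  \<open>A\<close>, with \<open>c\<close> becoming \<open>trunc_const c\<close>, so the
  representative does not matter. Written as a linear extension, the inclusion is visibly additive
  and \<open>k\<close>-linear.\<close>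

lemma trunc_incl_tcls:
  "trunc_incl scale (tcls scale u) = tcls As (flift fs (\<lambda>xs. Poly_Mapping.single (map emb xs) 1) u)"
proof -
  interpret F: vector_space fs by (rule fs_module)
  let ?F = "\<lambda>xs. Poly_Mapping.single (map emb xs) (1 :: 'k trunc)"
  have N: "F.subspace (tensor_null As)"
    unfolding F.subspace_def by (simp add: A.null_add A.null_scale)
  have M: "mlin_mod (tensor_null As) scale fs n ?F" for n
    unfolding mlin_mod_def
    using A.rel_add_in_null A.rel_scale_in_null by (simp add: emb_add emb_scale)
  have "tcls As (\<Sum>xs\<in>Poly_Mapping.keys w. Poly_Mapping.single (map (\<lambda>x. (x, 0)) xs) (trunc_const (Poly_Mapping.lookup w xs)))
      = tcls As (flift fs ?F u)" if "tcls scale w = tcls scale u" for w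
  proof -
    have "flift fs ?F (w - u) \<in> tensor_null As"
      using that by (intro H.flift_null_all[OF F.module_axioms N M]) (simp add: H.tcls_eq_iff)
    moreover have "(\<lambda>x. (x, 0)) = (emb :: 'h \<Rightarrow> _)" by (simp add: emb_def fun_eq_iff)
    ultimately show ?thesis
      by (simp add: A.tcls_eq_iff F.flift_diff) (simp add: flift_def)
  qed
  then show ?thesis unfolding trunc_incl_def by (rule H.UN_tcls)
qed

lemma trunc_incl_pure: "trunc_incl scale (pure_tensor scale xs) = pure_tensor As (map emb xs)"
proof -
  interpret F: vector_space fs by (rule fs_module)
  show ?thesis by (simp add: pure_tensor_def trunc_incl_tcls)
qed

lemma trunc_incl_tadd:
  "X \<in> range (tcls scale) \<Longrightarrow> Y \<in> range (tcls scale) \<Longrightarrow>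
    trunc_incl scale (tadd scale X Y) = tadd As (trunc_incl scale X) (trunc_incl scale Y)"
proof -
  interpret F: vector_space fs by (rule fs_module)
  show "X \<in> range (tcls scale) \<Longrightarrow> Y \<in> range (tcls scale) \<Longrightarrow> ?thesis"
    by (auto simp: trunc_incl_tcls F.flift_add)
qed

lemma trunc_incl_tscale:
  "X \<in> range (tcls scale) \<Longrightarrow>
    trunc_incl scale (tscale scale c X) = tscale As (trunc_const c) (trunc_incl scale X)"
proof -
  interpret F: vector_space fs by (rule fs_module)
  show "X \<in> range (tcls scale) \<Longrightarrow> ?thesis"
    by (auto simp: trunc_incl_tcls F.flift_fscale)
qed

lemma trunc_incl_tzero: "trunc_incl scale (tzero scale) = tzero As"
proof -
  interpret F: vector_space fs by (rule fs_module)
  show ?thesis by (simp add: tzero_def trunc_incl_tcls)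
qed

lemma trunc_incl_in: "X \<in> tensor_power scale n \<Longrightarrow> trunc_incl scale X \<in> tensor_power As n"
  by (induction rule: H.tpower_induct)
    (simp_all add: trunc_incl_tzero trunc_incl_pure trunc_incl_tadd trunc_incl_tscale H.tensor_range)

lemma trunc_incl_tlsum:
  "(\<And>a b. F a b \<in> range (tcls scale)) \<Longrightarrow>
    trunc_incl scale (tlsum scale l F) = tlsum As l (\<lambda>a b. trunc_incl scale (F a b))"
  by (induction l) (simp_all add: trunc_incl_tzero trunc_incl_tadd)

text \<open>Every entry has the form x + t y with x, y from \<open>H\<close>, so pure tensors with
  entries from \<open>H\<close> generate the power over k[[t]]/(t^2).\<close>

lemma tlinear_emb_eqI:
  assumes f: "f \<in> tlinear As m n" and g: "g \<in> tlinear As m n" and X: "X \<in> tensor_power As m"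
    and eq: "\<And>xs. length xs = m \<Longrightarrow> f (pure_tensor As (map emb xs)) = g (pure_tensor As (map emb xs))"
  shows "f X = g X"
proof (rule A.tlinear_eqI[OF f g X])
  \<comment> \<open>The prefix already comes from \<open>H\<close> and \<open>zs\<close> is
    arbitrary; the induction splits the head of \<open>zs\<close> and moves both of its components
    into the prefix.\<close>
  have *: "length xs + length zs = m \<Longrightarrow>
      f (pure_tensor As (map emb xs @ zs)) = g (pure_tensor As (map emb xs @ zs))" for xs zs
  proof (induction zs arbitrary: xs)
    case Nil
    then show ?case using eq by simp
  next
    case (Cons z zs)
    have in1: "pure_tensor As (map emb xs @ w # zs) \<in> tensor_power As m" for w
      using Cons.prems by (intro A.pure_in) simp
    have "h (pure_tensor As (map emb xs @ z # zs)) = tadd As (h (pure_tensor As (map emb (xs @ [fst z]) @ zs)))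
       (tscale As trunc_t (h (pure_tensor As (map emb (xs @ [snd z]) @ zs))))" if h: "h \<in> tlinear As m n" for h
      by (subst emb_decomp[of z])
        (simp add: A.pure_add A.pure_scale A.tlinear_add[OF h] A.tlinear_scale[OF h] in1)
    from this[OF f] this[OF g] show ?case
      using Cons.IH[of "xs @ [fst z]"] Cons.IH[of "xs @ [snd z]"] Cons.prems by simp
  qed
  show "f (pure_tensor As zs) = g (pure_tensor As zs)" if "length zs = m" for zs
    using *[of "[]" zs] that by simp
qed

text \<open>Any linear \<open>h\<close> with the right values on pure tensors over \<open>H\<close>,
  restricted to be extensional, witnesses existence for the definite description; generation by
  \<open>H\<close> gives uniqueness. What remains is to exhibit such an \<open>h\<close> in arity
  one and two.\<close>

lemma trunc_ext_props:
  assumes f: "f \<in> tlinear scale m n" and h: "h \<in> tlinear As m n"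
    and eq: "\<And>xs. length xs = m \<Longrightarrow> h (pure_tensor As (map emb xs)) = trunc_incl scale (f (pure_tensor scale xs))"
  shows "trunc_ext scale m n f \<in> tlinear As m n \<and>
    (\<forall>xs. length xs = m \<longrightarrow> trunc_ext scale m n f (pure_tensor As (map emb xs)) = trunc_incl scale (f (pure_tensor scale xs)))"
proof -
  let ?P = "\<lambda>h. h \<in> tlinear As m n \<inter> extensional (tensor_power As m) \<and>
        (\<forall>X\<in>tensor_power scale m. h (trunc_incl scale X) = trunc_incl scale (f X))"
  define h' where "h' = restrict h (tensor_power As m)"
  have "h (trunc_incl scale X) = trunc_incl scale (f X)" if "X \<in> tensor_power scale m" for X
    using that
    by (induction rule: H.tpower_induct)
      (simp_all add: trunc_incl_tzero trunc_incl_pure trunc_incl_tadd trunc_incl_tscale H.tensor_range[of _ m] eq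
         A.tlinear_zero[OF h] H.tlinear_zero[OF f] A.tlinear_add[OF h] H.tlinear_add[OF f]
         A.tlinear_scale[OF h] H.tlinear_scale[OF f] trunc_incl_in H.tensor_range[OF H.tlinear_in[OF f]])
  then have P: "?P h'"
    using h by (auto simp: h'_def tlinear_def trunc_incl_in)
  have "\<exists>!h. ?P h"
  proof (rule ex1I[of _ h'])
    fix g assume g: "?P g"
    show "g = h'"
    proof
      fix X
      show "g X = h' X"
      proof (cases "X \<in> tensor_power As m")
        case True
        show ?thesis
        proof (rule tlinear_emb_eqI[of g m n h' X])
          fix xs :: "'h list" assume "length xs = m"
          then have "g (trunc_incl scale (pure_tensor scale xs)) = h' (trunc_incl scale (pure_tensor scale xs))"
            using g P by simp
          then show "g (pure_tensor As (map emb xs)) = h' (pure_tensor As (map emb xs))"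
            by (simp add: trunc_incl_pure)
        qed (use g P True in auto)
      next
        case False
        then show ?thesis using g P by (auto simp: extensional_def)
      qed
    qed
  qed (rule P)
  from theI'[OF this] have "?P (trunc_ext scale m n f)" unfolding trunc_ext_def .
  then show ?thesis
    by (metis IntD1 H.pure_in trunc_incl_pure)
qed

section \<open>Construction of the linear extensions in arity one and two\<close>

definition semilin :: "nat \<Rightarrow> ('h \<Rightarrow> ('k trunc, 'h \<times> 'h) tensor) \<Rightarrow> bool" where
  "semilin n G \<longleftrightarrow> (\<forall>x. G x \<in> tensor_power As n) \<and> (\<forall>x y. G (x + y) = tadd As (G x) (G y)) \<and>
     (\<forall>c x. G (scale c x) = tscale As (trunc_const c) (G x))"

text \<open>The value G(x) + t G(y) at x + t y, as in \<open>trunc_scale_universal\<close>, here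
  with a tensor power as target, which is a set of cosets and not a module type.\<close>

definition ext1 :: "('h \<Rightarrow> ('k trunc, 'h \<times> 'h) tensor) \<Rightarrow> 'h \<times> 'h \<Rightarrow> ('k trunc, 'h \<times> 'h) tensor" where
  "ext1 G z = tadd As (G (fst z)) (tscale As trunc_t (G (snd z)))"

lemma ext1_tcls: "ext1 (\<lambda>x. tcls As (h x)) z = tcls As (h (fst z) + fscale trunc_t (h (snd z)))"
  by (simp add: ext1_def)

lemma ext1_in: "semilin n G \<Longrightarrow> ext1 G z \<in> tensor_power As n"
  by (auto simp: ext1_def semilin_def)

lemma ext1_add:
  assumes "semilin n G" shows "ext1 G (z + w) = tadd As (ext1 G z) (ext1 G w)"
proof -
  \<comment> \<open>Representatives move the claim about cosets into the free module, where the
    module laws are available.\<close>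
  have "\<exists>u. G x = tcls As u" for x using assms unfolding semilin_def tensor_power_def by blast
  then obtain g where g: "\<And>x. G x = tcls As (g x)" by metis
  have "G (x + y) = tcls As (g x + g y)" for x y
    using assms by (simp add: semilin_def g)
  then show ?thesis by (simp add: ext1_def g free.scale_right_distrib algebra_simps)
qed

lemma ext1_scale:
  assumes "semilin n G" shows "ext1 G (As c z) = tscale As c (ext1 G z)"
proof -
  have "\<exists>u. G x = tcls As u" for x using assms unfolding semilin_def tensor_power_def by blast
  then obtain g where g: "\<And>x. G x = tcls As (g x)" by metis
  have add: "G (x + y) = tadd As (G x) (G y)" and scale: "G (scale a x) = tscale As (trunc_const a) (G x)" for x y a
    using assms by (simp_all add: semilin_def)
  have components: "fst (As c z) = scale (trunc_coeff0 c) (fst z)"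
      "snd (As c z) = scale (trunc_coeff0 c) (snd z) + scale (trunc_coeff1 c) (fst z)"
    by (simp_all add: trunc_scale_def)
  have "ext1 G (As c z) = tcls As (fscale (trunc_const (trunc_coeff0 c)) (g (fst z)) +
      fscale trunc_t (fscale (trunc_const (trunc_coeff0 c)) (g (snd z)) + fscale (trunc_const (trunc_coeff1 c)) (g (fst z))))"
    by (unfold ext1_def components add scale) (simp add: g)
  \<comment> \<open>Expanding the product produces one further term, with coefficient t * t, which
    is 0.\<close>
  also have "\<dots> = tcls As (fscale (trunc_const (trunc_coeff0 c) + trunc_const (trunc_coeff1 c) * trunc_t) (g (fst z) + fscale trunc_t (g (snd z))))"
    by (simp add: free.scale_right_distrib free.scale_left_distrib mult.commute mult.assoc mult.left_commute distrib_left add_ac)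
  also have "\<dots> = tscale As c (ext1 G z)"
    by (simp add: ext1_def g flip: trunc_decomp)
  finally show ?thesis .
qed

lemma ext1_emb:
  assumes "semilin n G" shows "ext1 G (emb x) = G x"
proof -
  have in0: "G 0 \<in> tensor_power As n" and inx: "G x \<in> tensor_power As n" using assms by (auto simp: semilin_def)
  have "G (scale 0 0) = tscale As (trunc_const 0) (G 0)" using assms unfolding semilin_def by blast
  then have "G 0 = tzero As" using A.tscale_zero[OF in0] by simp
  then show ?thesis using A.tadd_tzero_right[OF inx] by (simp add: ext1_def emb_def)
qed

lemma semilin_trunc_incl:
  assumes f: "f \<in> tlinear scale m n" and l: "length xs + length ys + 1 = m"
  shows "semilin n (\<lambda>x. trunc_incl scale (f (pure_tensor scale (xs @ x # ys))))"
proof -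
  have p: "pure_tensor scale (xs @ x # ys) \<in> tensor_power scale m" for x
    using l by (intro H.pure_in) simp
  show ?thesis
    unfolding semilin_def H.pure_add H.pure_scale H.tlinear_add[OF f p p] H.tlinear_scale[OF f p]
    by (simp add: trunc_incl_in H.tlinear_in[OF f p] trunc_incl_tadd trunc_incl_tscale H.tensor_range[OF H.tlinear_in[OF f p]])
qed

lemma trunc_ext_1:
  assumes f: "f \<in> tlinear scale 1 n"
  shows "trunc_ext scale 1 n f \<in> tlinear As 1 n"
    and "trunc_ext scale 1 n f (pure_tensor As [emb x]) = trunc_incl scale (f (pure_tensor scale [x]))"
proof -
  let ?G = "\<lambda>x. trunc_incl scale (f (pure_tensor scale [x]))"
  have G: "semilin n ?G" using semilin_trunc_incl[OF f, of "[]" "[]"] by simp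
  have "A.tmultilin 1 n (\<lambda>zs. ext1 ?G (zs ! 0))"
    by (auto simp: A.tmultilin_def ext1_in[OF G] ext1_add[OF G] ext1_scale[OF G])
  note h = A.tlift_tlinear[OF this] A.tlift_pure[OF this]
  have "trunc_ext scale 1 n f \<in> tlinear As 1 n \<and>
    (\<forall>xs. length xs = 1 \<longrightarrow> trunc_ext scale 1 n f (pure_tensor As (map emb xs)) = trunc_incl scale (f (pure_tensor scale xs)))"
  proof (rule trunc_ext_props[OF f h(1)])
    fix xs :: "'h list" assume "length xs = 1"
    then obtain x where "xs = [x]" by (auto simp: length_Suc_conv)
    then show "tlift As 1 n (\<lambda>zs. ext1 ?G (zs ! 0)) (pure_tensor As (map emb xs)) = trunc_incl scale (f (pure_tensor scale xs))"
      by (simp add: h(2) ext1_emb[OF G] del: One_nat_def)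
  qed
  note r = this
  show "trunc_ext scale 1 n f \<in> tlinear As 1 n"
    by (rule r[THEN conjunct1])
  show "trunc_ext scale 1 n f (pure_tensor As [emb x]) = trunc_incl scale (f (pure_tensor scale [x]))"
    using r[THEN conjunct2, rule_format, of "[x]"] by simp
qed

lemma trunc_ext_2:
  assumes f: "f \<in> tlinear scale 2 n"
  shows "trunc_ext scale 2 n f \<in> tlinear As 2 n"
    and "trunc_ext scale 2 n f (pure_tensor As [emb x, emb y]) = trunc_incl scale (f (pure_tensor scale [x, y]))"
proof -
  let ?G = "\<lambda>x y. trunc_incl scale (f (pure_tensor scale [x, y]))"
  have G2: "semilin n (?G x)" for x using semilin_trunc_incl[OF f, of "[x]" "[]"] by simp
  have G1: "semilin n (\<lambda>x. ?G x y)" for y using semilin_trunc_incl[OF f, of "[]" "[y]"] by simp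
  \<comment> \<open>The second argument is extended to \<open>w\<close> in \<open>A\<close> while
    the first stays in \<open>H\<close>; \<open>ext1\<close> is then applied once more, in the first
    argument.\<close>
  let ?E = "\<lambda>w x. ext1 (?G x) w"
  have E: "semilin n (?E w)" for w
  proof -
    have in1: "\<exists>u. ?G x y = tcls As u" for x y
      using G2 unfolding semilin_def tensor_power_def by blast
    have g: "?G (x + x') y = tadd As (?G x y) (?G x' y)" "?G (scale c x) y = tscale As (trunc_const c) (?G x y)" for x x' y c
      using G1[of y] by (simp_all add: semilin_def)
    from in1 obtain h where h: "\<And>x y. ?G x y = tcls As (h x y)" by metis
    show ?thesis
      unfolding semilin_def
      by (intro conjI allI ext1_in[OF G2]; unfold ext1_def g)
        (simp_all add: h free.scale_right_distrib mult.commute add_ac)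
  qed
  have "A.tmultilin 2 n (\<lambda>zs. ext1 (?E (zs ! 1)) (zs ! 0))"
    unfolding A.tmultilin_def
  proof (intro conjI allI impI)
    fix zs :: "('h \<times> 'h) list"
    show "ext1 (?E (zs ! 1)) (zs ! 0) \<in> tensor_power As n" by (rule ext1_in[OF E])
  next
    fix xs ys :: "('h \<times> 'h) list" and x y c
    assume l: "length xs + length ys + 1 = 2"
    let ?F = "\<lambda>zs. ext1 (?E (zs ! 1)) (zs ! 0)"
    have in1: "\<exists>u. ?E w x = tcls As u" for w x
      by (rule A.tpowerE[OF ext1_in[OF G2, of x w]]) (rule exI)
    define e where "e w x = (SOME u. ?E w x = tcls As u)" for w x
    have e: "?E w x = tcls As (e w x)" for w x
      unfolding e_def by (rule someI_ex[OF in1])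
    from l consider z where "xs = []" "ys = [z]" | z where "xs = [z]" "ys = []"
    proof (cases xs)
      case Nil
      with l have "length ys = 1" by simp
      then obtain z where "ys = [z]" by (auto simp: length_Suc_conv)
      with Nil show ?thesis by (rule that(1))
    next
      case (Cons z zs)
      with l have "xs = [z]" "ys = []" by simp_all
      then show ?thesis by (rule that(2))
    qed
    then have "?F (xs @ (x + y) # ys) = tadd As (?F (xs @ x # ys)) (?F (xs @ y # ys)) \<and>
      ?F (xs @ As c x # ys) = tscale As c (?F (xs @ x # ys))"
    proof cases
      case 1
      then show ?thesis by (simp add: ext1_add[OF E] ext1_scale[OF E])
    next
      case 2
      have "?E (x + y) z = tadd As (?E x z) (?E y z)" "?E (As c x) z = tscale As c (?E x z)" for z
        by (rule ext1_add[OF G2], rule ext1_scale[OF G2])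
      then show ?thesis
        using 2 by (simp add: ext1_tcls e free.scale_right_distrib mult.commute add_ac)
    qed
    then show "?F (xs @ (x + y) # ys) = tadd As (?F (xs @ x # ys)) (?F (xs @ y # ys))"
      "?F (xs @ As c x # ys) = tscale As c (?F (xs @ x # ys))" by auto
  qed
  note h = A.tlift_tlinear[OF this] A.tlift_pure[OF this]
  have "trunc_ext scale 2 n f \<in> tlinear As 2 n \<and>
    (\<forall>xs. length xs = 2 \<longrightarrow> trunc_ext scale 2 n f (pure_tensor As (map emb xs)) = trunc_incl scale (f (pure_tensor scale xs)))"
  proof (rule trunc_ext_props[OF f h(1)])
    fix xs :: "'h list" assume "length xs = 2"
    then obtain x y where "xs = [x, y]" by (auto simp: length_Suc_conv eval_nat_numeral)
    then show "tlift As 2 n (\<lambda>zs. ext1 (?E (zs ! 1)) (zs ! 0)) (pure_tensor As (map emb xs)) = trunc_incl scale (f (pure_tensor scale xs))"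
      by (simp add: h(2) ext1_emb[OF G2] ext1_emb[OF G1] nth_Cons' del: One_nat_def)
  qed
  note r = this
  show "trunc_ext scale 2 n f \<in> tlinear As 2 n"
    by (rule r[THEN conjunct1])
  show "trunc_ext scale 2 n f (pure_tensor As [emb x, emb y]) = trunc_incl scale (f (pure_tensor scale [x, y]))"
    using r[THEN conjunct2, rule_format, of "[x, y]"] by simp
qed

text \<open>Forms with values in \<open>k[[t]]/(t\<^sup>2)\<close> separate the tensors over \<open>A\<close>: a \<open>k\<close>-linear functional \<open>g\<close> is turned into the \<open>k[[t]]/(t\<^sup>2)\<close>-linear map \<open>v \<mapsto> g (t v) + t g v\<close>.\<close>

lemma separating_form:
  assumes u: "u \<notin> tensor_null As"
  obtains \<psi> where "\<And>n. mlin As (*) n \<psi>" "flift (*) \<psi> u \<noteq> 0"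
proof -
  define C where "C a b = trunc_const a + trunc_const b * trunc_t" for a b :: 'k
  have C: "C (a + a') (b + b') = C a b + C a' b'" "C (c * a) (c * b) = trunc_const c * C a b" "C 0 a = trunc_t * C a b"
      "trunc_const a * d + trunc_const b * (trunc_t * d) = C a b * d" "C (trunc_coeff0 d) (trunc_coeff1 d) = d" "C a 1 \<noteq> 0"
      for a a' b b' c d
    by (simp_all add: C_def trunc_eq_iff algebra_simps)
  interpret F: vector_space "fs :: 'k \<Rightarrow> (('h \<times> 'h) list \<Rightarrow>\<^sub>0 'k trunc) \<Rightarrow> _" by (rule fs_module)
  interpret K: vector_space "(*) :: 'k \<Rightarrow> 'k \<Rightarrow> 'k" by unfold_locales (auto simp: algebra_simps)
  interpret P: vector_space_pair "fs :: 'k \<Rightarrow> (('h \<times> 'h) list \<Rightarrow>\<^sub>0 'k trunc) \<Rightarrow> _" "(*) :: 'k \<Rightarrow> 'k \<Rightarrow> 'k" ..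
  interpret T: module "(*) :: 'k trunc \<Rightarrow> 'k trunc \<Rightarrow> 'k trunc" by unfold_locales (auto simp: algebra_simps)
  have N: "F.subspace (tensor_null As)"
    unfolding F.subspace_def by (simp add: A.null_add A.null_scale)
  \<comment> \<open>A basis of the relations over the field \<open>k\<close>. Since \<open>u\<close>
    lies outside its span, a \<open>k\<close>-linear functional can be prescribed as 1 at
    \<open>u\<close> and 0 on all relations.\<close>
  obtain B where B: "B \<subseteq> tensor_null As" "F.independent B" "tensor_null As \<subseteq> F.span B"
    by (rule F.maximal_independent_subset)
  have "F.span B \<subseteq> tensor_null As" by (rule F.span_minimal[OF B(1) N])
  then have "u \<notin> F.span B" using u by blast
  then have "F.independent (insert u B)" by (simp add: F.independent_insert B(2))
  from P.linear_independent_extend[OF this, of "\<lambda>v. if v = u then 1 else 0"] obtain g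
    where g: "Vector_Spaces.linear fs (*) g" and gB: "\<forall>v\<in>insert u B. g v = (if v = u then 1 else 0)" by blast
  interpret g: Vector_Spaces.linear fs "(*)" g by (rule g)
  have "u \<notin> B" using u B(1) by blast
  then have gu: "g u = 1" and "\<And>v. v \<in> B \<Longrightarrow> g v = 0" using gB by auto
  then have g0: "g v = 0" if "v \<in> tensor_null As" for v
    using g.eq_0_on_span[of B v] that B(3) by blast
  \<comment> \<open>The coefficient of t in \<open>G v\<close> is \<open>g v\<close>; linearity over
    k[[t]]/(t^2) then forces the constant coefficient, since multiplication by t turns it into the
    coefficient of t in \<open>G (fscale trunc_t v)\<close>, which is
    \<open>g (fscale trunc_t v)\<close>.\<close>
  define G where "G v = C (g (fscale trunc_t v)) (g v)" for v
  have G_add: "G (v + w) = G v + G w" for v w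
    by (simp add: G_def free.scale_right_distrib g.add C)
  have G_k: "G (fs c v) = trunc_const c * G v" for c v
  proof -
    have "fscale trunc_t (fs c v) = fs c (fscale trunc_t v)" by (simp add: mult.commute)
    then have 1: "g (fscale trunc_t (fs c v)) = c * g (fscale trunc_t v)" by (simp only: g.scale)
    show ?thesis unfolding G_def 1 g.scale by (rule C)
  qed
  have G_t: "G (fscale trunc_t v) = trunc_t * G v" for v
    \<comment> \<open>Multiplying \<open>C a b\<close> by t forgets \<open>b\<close>, which is
      filled with \<open>g v\<close>; the other term contains t * t.\<close>
    unfolding G_def C(3)[of _ "g v", symmetric] by (simp add: g.zero)
  have G_scale: "G (fscale c v) = c * G v" for c v
  proof -
    have "fscale (trunc_const (trunc_coeff0 c) + trunc_const (trunc_coeff1 c) * trunc_t) v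
        = fs (trunc_coeff0 c) v + fs (trunc_coeff1 c) (fscale trunc_t v)"
      by (simp add: free.scale_left_distrib)
    then have "G (fscale c v) = G (fs (trunc_coeff0 c) v) + G (fs (trunc_coeff1 c) (fscale trunc_t v))"
      by (simp only: G_add flip: trunc_decomp)
    then show ?thesis by (simp only: G_k G_t C)
  qed
  have G_null: "G v = 0" if "v \<in> tensor_null As" for v
    using that C(2)[of 0 0 0] by (simp add: G_def g0 A.null_scale)
  have G_eq: "G v = G w" if "v - w \<in> tensor_null As" for v w
    using G_add[of "v - w" w] G_null[OF that] by simp
  define \<psi> where "\<psi> xs = G (Poly_Mapping.single xs 1)" for xs
  have "mlin As (*) n \<psi>" for n
    unfolding mlin_iff \<psi>_def
  proof (intro allI impI conjI)
    fix xs ys x y c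
    show "G (Poly_Mapping.single (xs @ (x + y) # ys) 1) =
        G (Poly_Mapping.single (xs @ x # ys) 1) + G (Poly_Mapping.single (xs @ y # ys) 1)"
      unfolding G_add[symmetric] by (rule G_eq) (use A.rel_add_in_null in \<open>simp add: diff_diff_eq\<close>)
    show "G (Poly_Mapping.single (xs @ As c x # ys) 1) = c * G (Poly_Mapping.single (xs @ x # ys) 1)"
      unfolding G_scale[symmetric] by (rule G_eq) (use A.rel_scale_in_null in simp)
  qed
  moreover have "flift (*) \<psi> v = G v" for v
  proof -
    have "G (\<Sum>x\<in>K. Poly_Mapping.single x (f x)) = (\<Sum>x\<in>K. f x * \<psi> x)" for K and f :: "_ \<Rightarrow> 'k trunc"
    proof (induction K rule: infinite_finite_induct)
      case (insert x K)
      then show ?case using G_scale[of "f x" "Poly_Mapping.single x 1"] by (simp add: G_add \<psi>_def)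
    qed (simp_all add: G_null)
    from this[of "Poly_Mapping.lookup v" "Poly_Mapping.keys v"] show ?thesis
      by (simp add: flift_def flip: free_decomp)
  qed
  \<comment> \<open>Its coefficient of t is \<open>g u\<close>, that is 1, whatever the constant
    coefficient may be.\<close>
  moreover have "G u \<noteq> 0"
    unfolding G_def gu by (rule C)
  ultimately show ?thesis by (intro that) auto
qed

text \<open>Turns an equation of tensors over \<open>A\<close> into equations of scalars in
  k[[t]]/(t^2), where Sweedler sums can be rearranged.\<close>

lemma tensor_eqI:
  assumes X: "X \<in> tensor_power As n" and Y: "Y \<in> tensor_power As n"
    and eq: "\<And>\<psi>. mlin As (*) n \<psi> \<Longrightarrow> A.teval (*) n \<psi> X = A.teval (*) n \<psi> Y"
  shows "X = Y"
proof (rule ccontr)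
  interpret T: module "(*) :: 'k trunc \<Rightarrow> 'k trunc \<Rightarrow> 'k trunc" by unfold_locales (auto simp: algebra_simps)
  assume ne: "X \<noteq> Y"
  obtain u v where u: "X = tcls As u" "u \<in> A.hom_elts n" and v: "Y = tcls As v" "v \<in> A.hom_elts n"
    using X Y by (elim A.tpowerE) 
  have "u - v \<notin> tensor_null As" using ne u v by (simp add: A.tcls_eq_iff)
  then obtain \<psi> where \<psi>: "\<And>n. mlin As (*) n \<psi>" "flift (*) \<psi> (u - v) \<noteq> 0" by (rule separating_form) blast
  \<comment> \<open>\<open>teval\<close> ignores lists of other lengths, which changes nothing on
    homogeneous representatives.\<close>
  have "A.teval (*) n \<psi> (tcls As w) = flift (*) \<psi> w" if "w \<in> A.hom_elts n" for w
    using that unfolding A.teval_tcls[OF T.module_axioms \<psi>(1)] flift_def A.hom_elts_def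
    by (intro sum.cong) auto
  then show False using eq[OF \<psi>(1)] \<psi>(2) u v by (simp add: T.flift_diff)
qed

end

section \<open>The Yang--Baxter equation\<close>

context tensor_module
begin

lemma tlinear_tadd:
  assumes f: "f \<in> tlinear s m n" and g: "g \<in> tlinear s m n"
  shows "(\<lambda>X. tadd s (f X) (g X)) \<in> tlinear s m n"
proof -
  have ac: "tadd s (tadd s A B) (tadd s C D) = tadd s (tadd s A C) (tadd s B D)"
    if "A \<in> tensor_power s n" "B \<in> tensor_power s n" "C \<in> tensor_power s n" "D \<in> tensor_power s n" for A B C D
    using that by (auto elim!: tpowerE simp: algebra_simps)
  show ?thesis
    unfolding tlinear_def
    by (auto simp: tlinear_add[OF f] tlinear_add[OF g] tlinear_scale[OF f] tlinear_scale[OF g]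
        ac tlinear_in[OF f] tlinear_in[OF g] tscale_tadd[where n = n])
qed

lemma tlinear_tscale:
  assumes f: "f \<in> tlinear s m n"
  shows "(\<lambda>X. tscale s c (f X)) \<in> tlinear s m n"
proof -
  have comm: "tscale s c (tscale s d A) = tscale s d (tscale s c A)" if "A \<in> tensor_power s n" for A d
    using that by (auto elim!: tpowerE simp: mult.commute)
  show ?thesis
    unfolding tlinear_def
    by (auto simp: tlinear_add[OF f] tlinear_scale[OF f] comm tlinear_in[OF f] tscale_tadd[where n = n])
qed

lemma R_map_tlinear:
  assumes D: "\<Delta> \<in> tlinear s 1 2" and q: "q \<in> tlinear s 2 1"
  shows "R_map s \<Delta> q \<in> tlinear s 2 2"
proof -
  note l = tmap_tlinear tflip_tlinear id_tlinear D q
  have 1: "tmap s (1, 1) id (1, 2) \<Delta> \<in> tlinear s 2 3"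
    and 2: "tmap s (2, 2) (tflip s) (1, 1) id \<in> tlinear s 3 3"
    and 3: "tmap s (1, 1) id (2, 1) q \<in> tlinear s 3 2"
    by (simp_all add: l del: One_nat_def)
  show ?thesis
    unfolding R_map_def[abs_def] by (intro tlinear_comp[OF _ 3] tlinear_comp[OF _ 2] 1)
qed

lemma R_map_pure:
  assumes D: "\<Delta> \<in> tlinear s 1 2" and q: "q \<in> tlinear s 2 1"
  shows "R_map s \<Delta> q (pure_tensor s [x, y]) = tlsum s (cop \<Delta> y) (\<lambda>a b. pure_tensor s [a, fun2 q x b])"
  by (simp add: R_map_def tensor_eval D q cop[OF D] fun2[OF q] del: One_nat_def)

lemma trilin_of_mlin:
  assumes "mlin s sW 3 \<psi>" shows "trilin s sW (\<lambda>x y z. \<psi> [x, y, z])"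
proof -
  note m = assms[unfolded mlin_iff, rule_format]
  from m[of "[]" "[_, _]"] m[of "[_]" "[_]"] m[of "[_, _]" "[]"] show ?thesis
    by (simp add: trilin_def lin_def)
qed

end

context hopf_algebra
begin

interpretation X: trunc_extension scale
  by unfold_locales

text \<open>k[[t]]/(t^2) as a module over \<open>k\<close>, the target with which the identities for
  \<open>H\<close> are instantiated.\<close>

abbreviation "cof \<equiv> (\<lambda>c r. trunc_const c * r) :: 'k \<Rightarrow> 'k trunc \<Rightarrow> 'k trunc"

lemma cof_module: "module cof"
  by unfold_locales (simp_all add: algebra_simps)

lemma trunc_module: "module ((*) :: 'k trunc \<Rightarrow> 'k trunc \<Rightarrow> 'k trunc)"
  by unfold_locales (simp_all add: algebra_simps)

lemma trunc_ext_comult: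
  shows "trunc_ext scale 1 2 \<Delta> \<in> tlinear X.As 1 2"
    and "trunc_ext scale 1 2 \<Delta> (pure_tensor X.As [emb x]) = tlsum X.As (cop \<Delta> x) (\<lambda>a b. pure_tensor X.As [emb a, emb b])"
  by (simp_all add: X.trunc_ext_1[OF comult_linear] cop[OF comult_linear] X.trunc_incl_tlsum X.trunc_incl_pure del: One_nat_def)

lemma trunc_ext_deformation:
  assumes \<phi>: "\<phi> \<in> tlinear scale 2 1"
  defines "q \<equiv> \<lambda>X. tadd X.As (trunc_ext scale 2 1 (adjoint_map scale \<mu> \<Delta> S) X)
      (tscale X.As trunc_t (trunc_ext scale 2 1 \<phi> X))"
  shows "q \<in> tlinear X.As 2 1"
    and "q (pure_tensor X.As [emb x, emb y]) = pure_tensor X.As [emb (ad x y) + X.As trunc_t (emb (fun2 \<phi> x y))]"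
proof -
  show "q \<in> tlinear X.As 2 1"
    unfolding q_def
    by (intro X.A.tlinear_tadd X.A.tlinear_tscale X.trunc_ext_2(1) adjoint_linear \<phi>)
  show "q (pure_tensor X.As [emb x, emb y]) = pure_tensor X.As [emb (ad x y) + X.As trunc_t (emb (fun2 \<phi> x y))]"
    by (simp add: q_def X.trunc_ext_2(2)[OF adjoint_linear] X.trunc_ext_2(2)[OF \<phi>]
      adjoint_pure fun2[OF \<phi>] X.trunc_incl_pure X.A.tscale_pure_Cons X.A.tadd_pure_1 del: One_nat_def)
qed

section \<open>The Yang-Baxter computation, from linearity and values on \<open>H\<close>\<close>

context
  fixes \<phi> \<Delta>\<^sub>A q
  assumes \<phi>: "\<phi> \<in> adjoint_2_cocycles scale \<mu> \<Delta> S"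
    and ext_comult_linear: "\<Delta>\<^sub>A \<in> tlinear X.As 1 2"
    and ext_comult_emb: "\<And>x. \<Delta>\<^sub>A (pure_tensor X.As [emb x])
      = tlsum X.As (cop \<Delta> x) (\<lambda>a b. pure_tensor X.As [emb a, emb b])"
    and q_linear: "q \<in> tlinear X.As 2 1"
    and q_emb: "\<And>x y. q (pure_tensor X.As [emb x, emb y])
      = pure_tensor X.As [emb (ad x y) + X.As trunc_t (emb (fun2 \<phi> x y))]"
begin

lemmas phi_linear = cocycle_linear[OF \<phi>]

abbreviation phi where "phi \<equiv> fun2 \<phi>"
abbreviation Q where "Q \<equiv> X.A.fun2 q"
abbreviation swA where "swA y F \<equiv> lsum (X.A.cop \<Delta>\<^sub>A y) F"

lemma Q_emb: "Q (emb x) (emb y) = emb (ad x y) + X.As trunc_t (emb (phi x y))"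
  by (rule X.A.fun2_eqI) (rule q_emb)

text \<open>The lists chosen for \<Delta> and for its extension are unrelated; they represent the
  same tensor, so sums against a bilinear map agree.\<close>

lemma swA_emb:
  assumes "bilin X.As (*) F" shows "swA (emb x) F = sw x (\<lambda>a b. F (emb a) (emb b))"
  unfolding X.A.lsum_cop_eq_teval[OF ext_comult_linear trunc_module assms] ext_comult_emb
  by (simp add: X.A.teval_tlsum[OF trunc_module mlin_2[OF assms], where m = 2]
    X.A.teval_pure_2[OF trunc_module assms] del: One_nat_def)

lemma swA_simps:
  assumes "bilin X.As (*) F" 
  shows "swA (x + y) F = swA x F + swA y F" "swA (X.As c x) F = c * swA x F"
  using X.A.lin_lsum_cop[OF ext_comult_linear trunc_module assms] unfolding lin_def by blast+

lemmas Q_bilin = X.A.bilin_fun2[OF q_linear]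

lemmas Q_simps = Q_bilin[unfolded lin_defs, THEN conjunct1, rule_format, THEN conjunct1, rule_format]
  Q_bilin[unfolded lin_defs, THEN conjunct1, rule_format, THEN conjunct2, rule_format]
  Q_bilin[unfolded lin_defs, THEN conjunct2, rule_format, THEN conjunct1, rule_format]
  Q_bilin[unfolded lin_defs, THEN conjunct2, rule_format, THEN conjunct2, rule_format]

text \<open>The term in which \<open>\<phi>\<close> is applied twice carries t * t and vanishes; the
  rest is \<open>ad_ad\<close> and \<open>cocycle_ad\<close>.\<close>

lemma Q_Q: "Q (Q (emb x) (emb y)) (emb z) = Q (emb x) (emb (y \<star> z))"
proof -
  have "Q (Q (emb x) (emb y)) (emb z) = emb (ad (ad x y) z) + X.As trunc_t (emb (ad (phi x y) z + phi (ad x y) z))"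
    by (simp add: Q_emb Q_simps emb_add X.A.scale_right_distrib)
  then show ?thesis by (simp add: Q_emb ad_ad cocycle_ad[OF \<phi>])
qed

text \<open>The two sides of the Yang-Baxter equation at \<open>x\<close>, \<open>y\<close>,
  \<open>z\<close> from \<open>H\<close>, seen through a trilinear form. Rewriting them over
  \<open>H\<close> makes the identities for \<Delta>, ad and \<open>\<phi>\<close>
  applicable.\<close>

lemma YBE_forms:
  assumes T: "trilin X.As (*) T"
  shows "swA (emb y) (\<lambda>a b. swA (emb z) (\<lambda>c d. swA c (\<lambda>e f. T e (Q a f) (Q (Q (emb x) b) d))))
    = swA (emb z) (\<lambda>a b. swA a (\<lambda>c d. swA (Q (emb y) b) (\<lambda>p r. T c p (Q (Q (emb x) d) r))))"
proof -
  note R_scale = module.lsum_scale[OF trunc_module]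
  note simps = lin_defs mul_simps anti_simps lsum_add R_scale distrib_left mult.left_commute
    T[unfolded lin_defs, rule_format] swA_simps Q_simps emb_add X.emb_scale sw_simps[OF cof_module]
  \<comment> \<open>Once (1) has merged the nested \<open>Q\<close> in the last slot, this is the
    shape common to both sides.\<close>
  define F where "F e u v = T (emb e) (emb u) (Q (emb x) (emb v))" for e u v
  have F: "trilin scale cof F"
    by (simp add: F_def simps)
  note Fsimps = lin_defs F[unfolded lin_defs, rule_format] mul_simps lsum_add R_scale distrib_left mult.left_commute
    ad_bilin[unfolded lin_defs, rule_format] bilin_fun2[OF phi_linear, unfolded lin_defs, rule_format]
  have F2: "bilin scale cof (F e)" for e
    by (simp add: Fsimps)
  have TQ: "T e (Q (emb a) (emb f)) w = T e (emb (ad a f)) w + trunc_t * T e (emb (phi a f)) w" for e a f w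
    by (simp add: Q_emb simps)
  have "swA (emb y) (\<lambda>a b. swA (emb z) (\<lambda>c d. swA c (\<lambda>e f. T e (Q a f) (Q (Q (emb x) b) d))))
     = sw y (\<lambda>a b. sw z (\<lambda>c d. sw c (\<lambda>e f. T (emb e) (Q (emb a) (emb f)) (Q (Q (emb x) (emb b)) (emb d)))))"
    by (simp add: swA_emb simps)
  also have "\<dots> = sw y (\<lambda>a b. sw z (\<lambda>c d. sw c (\<lambda>e f. F e (ad a f) (b \<star> d) + trunc_t * F e (phi a f) (b \<star> d))))"
    by (simp add: TQ Q_Q F_def)
  also have "\<dots> = sw y (\<lambda>a b. sw z (\<lambda>e c. sw c (\<lambda>f d. F e (ad a f) (b \<star> d) + trunc_t * F e (phi a f) (b \<star> d))))"
    by (subst sw_coassoc[OF cof_module]) (simp_all add: Fsimps)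
  also have "\<dots> = sw z (\<lambda>e c. sw y (\<lambda>a b. sw c (\<lambda>f d. F e (ad a f) (b \<star> d) + trunc_t * F e (phi a f) (b \<star> d))))"
    by (rule lsum_swap)
  also have "\<dots> = sw z (\<lambda>e c. sw y (\<lambda>a b. sw c (\<lambda>f d. F e (ad a f) (b \<star> d))) +
      trunc_t * sw y (\<lambda>a b. sw c (\<lambda>f d. F e (phi a f) (b \<star> d))))"
    by (simp add: lsum_add R_scale)
  \<comment> \<open>For fixed \<open>e\<close> the map \<open>F e\<close> is bilinear, so (2)
    applies to each coefficient separately: \<open>sw_ad\<close> to the constant one and
    \<open>sw_cocycle\<close> to that of t.\<close>
  also have "\<dots> = sw z (\<lambda>e c. sw c (\<lambda>d b. sw (ad y b) (\<lambda>p r. F e p (d \<star> r))) +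
      trunc_t * sw c (\<lambda>d b. sw (phi y b) (\<lambda>p r. F e p (d \<star> r))))"
    by (simp only: sw_ad[OF cof_module F2] sw_cocycle[OF \<phi> cof_module F2])
  also have "\<dots> = sw z (\<lambda>c a. sw a (\<lambda>d b. sw (ad y b) (\<lambda>p r. F c p (d \<star> r)) +
      trunc_t * sw (phi y b) (\<lambda>p r. F c p (d \<star> r))))"
    by (simp add: lsum_add R_scale)
  \<comment> \<open>Read from right to left: linearity splits \<open>Q (emb y) (emb b)\<close> into
    its two coefficients, and \<open>Q_Q\<close> folds the nested \<open>Q\<close> into
    \<open>F\<close>.\<close>
  also have "\<dots> = sw z (\<lambda>c a. sw a (\<lambda>d b. swA (Q (emb y) (emb b)) (\<lambda>p r. T (emb c) p (Q (Q (emb x) (emb d)) r))))"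
    by (simp add: Q_emb[of y] swA_emb simps) (simp add: Q_Q F_def)
  also have "\<dots> = sw z (\<lambda>a b. sw a (\<lambda>c d. swA (Q (emb y) (emb b)) (\<lambda>p r. T (emb c) p (Q (Q (emb x) (emb d)) r))))"
    by (subst sw_coassoc[OF cof_module]) (simp_all add: simps)
  also have "\<dots> = swA (emb z) (\<lambda>a b. swA a (\<lambda>c d. swA (Q (emb y) b) (\<lambda>p r. T c p (Q (Q (emb x) d) r))))"
    by (simp add: swA_emb simps)
  finally show ?thesis .
qed

text \<open>Two reductions lead to \<open>YBE_forms\<close>: from arbitrary tensors to entries from
  \<open>H\<close>, then from tensors to the values of all trilinear forms on them.\<close>

lemma YBE:
  defines "R \<equiv> R_map X.As \<Delta>\<^sub>A q"
  assumes X: "X \<in> tensor_power X.As 3"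
  shows "tmap X.As (2, 2) R (1, 1) id (tmap X.As (1, 1) id (2, 2) R (tmap X.As (2, 2) R (1, 1) id X)) =
    tmap X.As (1, 1) id (2, 2) R (tmap X.As (2, 2) R (1, 1) id (tmap X.As (1, 1) id (2, 2) R X))"
proof -
  have R: "R \<in> tlinear X.As 2 2"
    unfolding R_def by (rule X.A.R_map_tlinear[OF ext_comult_linear q_linear])
  have R_pure: "R (pure_tensor X.As [v, w]) = tlsum X.As (X.A.cop \<Delta>\<^sub>A w) (\<lambda>a b. pure_tensor X.As [a, Q v b])" for v w
    unfolding R_def by (rule X.A.R_map_pure[OF ext_comult_linear q_linear])
  have 1: "tmap X.As (2, 2) R (1, 1) id \<in> tlinear X.As 3 3" and 2: "tmap X.As (1, 1) id (2, 2) R \<in> tlinear X.As 3 3"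
    by (simp_all add: X.A.tmap_tlinear R X.A.id_tlinear del: One_nat_def)
  show ?thesis
  proof (rule X.tlinear_emb_eqI[OF _ _ X, where f = "\<lambda>X. tmap X.As (2, 2) R (1, 1) id (tmap X.As (1, 1) id (2, 2) R (tmap X.As (2, 2) R (1, 1) id X))"
      and g = "\<lambda>X. tmap X.As (1, 1) id (2, 2) R (tmap X.As (2, 2) R (1, 1) id (tmap X.As (1, 1) id (2, 2) R X))"])
    show l: "(\<lambda>X. tmap X.As (2, 2) R (1, 1) id (tmap X.As (1, 1) id (2, 2) R (tmap X.As (2, 2) R (1, 1) id X))) \<in> tlinear X.As 3 3"
      by (intro X.A.tlinear_comp[OF _ 1] X.A.tlinear_comp[OF _ 2] 1)
    show r: "(\<lambda>X. tmap X.As (1, 1) id (2, 2) R (tmap X.As (2, 2) R (1, 1) id (tmap X.As (1, 1) id (2, 2) R X))) \<in> tlinear X.As 3 3"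
      by (intro X.A.tlinear_comp[OF _ 1] X.A.tlinear_comp[OF _ 2] 2)
    fix xs :: "'h list"
    assume "length xs = 3"
    then obtain x y z where xs: "xs = [x, y, z]" by (auto simp: length_Suc_conv eval_nat_numeral)
    let ?X = "pure_tensor X.As (map emb xs)"
    have X: "?X \<in> tensor_power X.As 3" using \<open>length xs = 3\<close> by (intro X.A.pure_in) simp
    show "tmap X.As (2, 2) R (1, 1) id (tmap X.As (1, 1) id (2, 2) R (tmap X.As (2, 2) R (1, 1) id ?X)) =
      tmap X.As (1, 1) id (2, 2) R (tmap X.As (2, 2) R (1, 1) id (tmap X.As (1, 1) id (2, 2) R ?X))"
    proof (rule X.tensor_eqI[OF X.A.tlinear_in[OF l X] X.A.tlinear_in[OF r X]])
      fix \<psi> :: "('h \<times> 'h) list \<Rightarrow> 'k trunc"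
      assume \<psi>: "mlin X.As (*) 3 \<psi>"
      have p: "X.A.teval (*) 3 \<psi> (pure_tensor X.As [a, b, c]) = \<psi> [a, b, c]" for a b c
        by (rule X.A.teval_pure[OF trunc_module \<psi>]) simp
      show "X.A.teval (*) 3 \<psi> (tmap X.As (2, 2) R (1, 1) id (tmap X.As (1, 1) id (2, 2) R (tmap X.As (2, 2) R (1, 1) id ?X))) =
        X.A.teval (*) 3 \<psi> (tmap X.As (1, 1) id (2, 2) R (tmap X.As (2, 2) R (1, 1) id (tmap X.As (1, 1) id (2, 2) R ?X)))"
        using YBE_forms[OF X.A.trilin_of_mlin[OF \<psi>], of y z x]
        by (simp add: xs X.A.tensor_eval R R_pure X.A.teval_tlsum[OF trunc_module \<psi>, where m = 3] p del: One_nat_def)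
    qed
  qed
qed

end

end

theorem theorem7p1:
  fixes scale :: "'k::field \<Rightarrow> 'h::ab_group_add \<Rightarrow> 'h"
    and \<mu> \<eta> \<Delta> \<epsilon> S \<phi> :: "('k, 'h) tensor \<Rightarrow> ('k, 'h) tensor"
  assumes "hopf_algebra scale \<mu> \<eta> \<Delta> \<epsilon> S"
    and "\<phi> \<in> adjoint_2_cocycles scale \<mu> \<Delta> S"
  shows "let A = trunc_scale scale;
             \<Delta>\<^sub>A = trunc_ext scale 1 2 \<Delta>;
             ad\<^sub>A = trunc_ext scale 2 1 (adjoint_map scale \<mu> \<Delta> S);
             \<phi>\<^sub>A = trunc_ext scale 2 1 \<phi>;
             R = R_map A \<Delta>\<^sub>A (\<lambda>X. tadd A (ad\<^sub>A X) (tscale A trunc_t (\<phi>\<^sub>A X)))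
         in \<forall>X\<in>tensor_power A 3.
              tmap A (2, 2) R (1, 1) id (tmap A (1, 1) id (2, 2) R (tmap A (2, 2) R (1, 1) id X)) =
              tmap A (1, 1) id (2, 2) R (tmap A (2, 2) R (1, 1) id (tmap A (1, 1) id (2, 2) R X))"
proof -
  interpret hopf_algebra scale \<mu> \<eta> \<Delta> \<epsilon> S by fact
  note \<phi> = cocycle_linear[OF assms(2)]
  show ?thesis
    unfolding Let_def
    using YBE[OF assms(2) trunc_ext_comult trunc_ext_deformation[OF \<phi>]] by blast
qed

end
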